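(* Let $N\ge 2$ be an integer and let $f:\mathbb{R}\to\mathbb{R}$. Put $F(s):=\int_0^s f(t)\,dt$. Consider the following conditions. (f1) $f(0)=0$; (f2) $f$ is locally Lipschitz in $[0,+\infty)$; (f3) $\alpha:=\inf\{\xi>0\mid f(\xi)\ge 0\}$ exists and $\alpha>0$; (f4) $\lim_{s\to\alpha^+}\frac{f(s)}{s-\alpha}>0$; (f5) there exists $\gamma>0$ such that $F(\gamma)>0$; (f6) $f(\xi)>0$ for every $\xi\in(\alpha,\xi_0]$, where $\xi_0:=\inf\{\xi>0\mid F(\xi)>0\}$. Suppose that either $N\ge 3$ and $f$ satisfies (f1), (f2), (f3), (f4), (f5), (f6), or $N=2$ and $f$ satisfies (f1), (f2), (f3), (f5), (f6). Then the problem $$\left\{\begin{array}{ll}\nabla\cdot\left[\dfrac{\nabla u}{\sqrt{1-|\nabla u|^2}}\right]+f(u)=0, & x\in\mathbb{R}^N,\\ u(x)>0 & \text{in }\mathbb{R}^N,\\ u(x)\to 0 & \text{as }|x|\to\infty,\end{array}\right.$$ has a radially decreasing solution.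
   Context: A solution is understood in the classical sense ($u$ of class $C^2$ with $|\nabla u|<1$). "Radially decreasing" means that $u(x)=\bar u(|x|)$ for a decreasing function $\bar u$ on $[0,+\infty)$; such a profile is $C^2$ on $[0,+\infty)$, satisfies $\bar u'(0)=0$, and solves $\left(\frac{\bar u'}{\sqrt{1-(\bar u')^2}}\right)'+\frac{N-1}{r}\frac{\bar u'}{\sqrt{1-(\bar u')^2}}+f(\bar u)=0$ for $r>0$. Since only positive solutions are sought, $f$ is taken to be extended by $0$ on $(-\infty,0)$; only the values of $f$ on $[0,+\infty)$ matter. *)

theory Defs
  imports "HOL-Analysis.Analysis"
begin

definition primitive :: "(real \<Rightarrow> real) \<Rightarrow> real \<Rightarrow> real"
  where "primitive f s = (LBINT t=0..s. f t)"

text \<open>The two infima are only meaningful when the underlying sets are nonempty; this has to be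
  assumed (or to follow from the other hypotheses) wherever they are used.\<close>

definition alpha :: "(real \<Rightarrow> real) \<Rightarrow> real"
  where "alpha f = Inf {\<xi>. \<xi> > 0 \<and> f \<xi> \<ge> 0}"

definition xi0 :: "(real \<Rightarrow> real) \<Rightarrow> real"
  where "xi0 f = Inf {\<xi>. \<xi> > 0 \<and> primitive f \<xi> > 0}"

text \<open>\<^const>\<open>local_lipschitz\<close> is about functions with an additional parameter; the singleton
  parameter set makes it the usual notion for a single function.\<close>

definition locally_lipschitz_on :: "real set \<Rightarrow> (real \<Rightarrow> real) \<Rightarrow> bool"
  where "locally_lipschitz_on X f \<longleftrightarrow> local_lipschitz {0::real} X (\<lambda>_. f)"

definition gradient :: "(real ^ 'n \<Rightarrow> real) \<Rightarrow> real ^ 'n \<Rightarrow> real ^ 'n"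
  where "gradient u x = (THE D. GDERIV u x :> D)"

definition divergence :: "(real ^ 'n \<Rightarrow> real ^ 'n) \<Rightarrow> real ^ 'n \<Rightarrow> real"
  where "divergence V x = (\<Sum>i\<in>UNIV. frechet_derivative V (at x) (axis i 1) $ i)"

text \<open>The components of the vectors in the last conjunct are the second partial derivatives
  of \<open>u\<close>.\<close>

definition C2 :: "(real ^ 'n \<Rightarrow> real) \<Rightarrow> bool"
  where "C2 u \<longleftrightarrow> u differentiable_on UNIV \<and> gradient u differentiable_on UNIV \<and>
    (\<forall>i. continuous_on UNIV (\<lambda>x. frechet_derivative (gradient u) (at x) (axis i 1)))"

text \<open>For a \<open>C2\<close> function with gradient of norm less than 1, the gradient and the vector field under
  the divergence are differentiable, so \<^const>\<open>gradient\<close> and \<^const>\<open>divergence\<close> are evaluated only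
  where the derivatives exist.\<close>

definition classical_solution :: "(real \<Rightarrow> real) \<Rightarrow> (real ^ 'n \<Rightarrow> real) \<Rightarrow> bool"
  where "classical_solution f u \<longleftrightarrow> C2 u \<and> (\<forall>x. norm (gradient u x) < 1) \<and>
    (\<forall>x. divergence (\<lambda>y. gradient u y /\<^sub>R sqrt (1 - (norm (gradient u y))\<^sup>2)) x + f (u x) = 0) \<and>
    (\<forall>x. u x > 0) \<and> (u \<longlongrightarrow> 0) at_infinity"

definition radially_decreasing :: "(real ^ 'n \<Rightarrow> real) \<Rightarrow> bool"
  where "radially_decreasing u \<longleftrightarrow>
    (\<exists>v :: real \<Rightarrow> real. strict_antimono_on {0..} v \<and> (\<forall>x. u x = v (norm x)))"

end

theory Submission
  imports Defs
begin

text \<open>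
  A radial function \<open>u x = v (norm x)\<close> solves the equation iff its profile satisfies
  \<open>v' = w / sqrt (1 + w\<^sup>2)\<close> and \<open>w' + (m / r) w + f v = 0\<close> with \<open>v' 0 = w 0 = 0\<close>, where
  \<open>m\<close> is the dimension minus one and \<open>w = v' / sqrt (1 - v'\<^sup>2)\<close>; the momentum \<open>w\<close> may be large, but
  \<open>\<bar>v'\<bar> < 1\<close> always. The only free datum is \<open>\<xi> = v 0\<close>, and it is found by shooting. The profiles that
  matter take their values in an interval \<open>[0, M]\<close>, so that \<open>f\<close> may be replaced by a cutoff \<open>g\<close> that is
  bounded, globally Lipschitz and zero on the negative half line. The initial value problem is then
  globally solvable, with Lipschitz dependence on \<open>\<xi>\<close>, by a contraction in an exponentially weighted
  supremum norm (\<open>dist_picard_le\<close>).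

  The energy \<open>E = sqrt (1 + w\<^sup>2) - 1 + G v\<close>, where \<open>G\<close> is the primitive of \<open>g\<close>, satisfies
  \<open>E' = - (m / r) v' w\<close> and is therefore nonincreasing. Two sets of initial values are considered:
  those for which \<open>v\<close> becomes negative somewhere, and those for which \<open>E\<close> becomes negative
  somewhere. Both are open, by continuous dependence. They are disjoint: a profile
  that has become negative stays negative, and there \<open>E \<ge> 0\<close> because \<open>G\<close> vanishes. The second set
  contains \<open>\<xi>\<^sub>0\<close>, since \<open>E\<close> starts from \<open>G \<xi>\<^sub>0 = 0\<close> and strictly decreases.

  The first set contains some \<open>\<xi>\<^sub>2 > \<xi>\<^sub>0\<close> (\<open>profile_reaches_zero\<close>, \<open>reaching_amplitude\<close>): if \<open>v\<close> stays
  above a level \<open>\<xi>\<^sub>1 > \<xi>\<^sub>0\<close> up to a large radius \<open>R\<close>, the friction coefficient is at most \<open>m / R\<close> from then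
  on, and the energy, which is at least \<open>G \<xi>\<^sub>1 > 0\<close> when \<open>v\<close> comes down to \<open>\<xi>\<^sub>1\<close>, stays above a
  positive constant while \<open>v\<close> travels the remaining distance \<open>\<xi>\<^sub>1\<close> to zero. Such a late descent is arranged in one of
  two ways. If \<open>f\<close> has no zero beyond \<open>\<xi>\<^sub>0\<close>, a large \<open>\<xi>\<^sub>2\<close> suffices because \<open>\<bar>v'\<bar> < 1\<close>; otherwise
  \<open>\<xi>\<^sub>2\<close> is taken close to the first such zero, whose constant profile is an equilibrium.

  Since \<open>[\<xi>\<^sub>0, \<xi>\<^sub>2]\<close> is connected, some \<open>\<xi>\<close> in it belongs to neither set (\<open>shooting\<close>). Its profile and its energy
  are nonnegative throughout, which makes the profile strictly decreasing (\<open>momentum_neg\<close>). The limit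
  \<open>l\<close> of the profile satisfies \<open>g l = 0\<close> and \<open>G l = lim E \<ge> 0\<close> (\<open>decreasing_profile_limit\<close>); as \<open>G\<close> is negative on
  \<open>(0, \<xi>\<^sub>0)\<close> and \<open>g\<close> is positive on \<open>[\<xi>\<^sub>0, M)\<close>, the limit is \<open>0\<close>.

  It remains to see that \<open>v (norm x)\<close> is of class \<open>C\<^sup>2\<close> at the origin and that the divergence form of
  the equation holds there. Both the gradient and the field under the divergence have
  the form \<open>q (norm x) x\<close>, with \<open>q\<close> continuous on \<open>[0, \<infinity>)\<close> and \<open>r q' r\<close> tending to \<open>0\<close> at \<open>0\<close>, and such fields
  are continuously differentiable (\<open>radial_field_continuously_differentiable\<close>).
\<close>

section \<open>The initial value problem for radial profiles\<close>

text \<open>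
  The inverse of the map \<open>s \<mapsto> s / sqrt (1 - s\<^sup>2)\<close> from \<open>(-1, 1)\<close> onto the real line.
\<close>

definition velocity :: "real \<Rightarrow> real"
  where "velocity p = p / sqrt (1 + p\<^sup>2)"

lemma sqrt_one_plus_square_pos: "sqrt (1 + (p::real)\<^sup>2) > 0"
  by (simp add: add_pos_nonneg)

lemma velocity_has_real_derivative:
  "(velocity has_real_derivative 1 / sqrt (1 + p\<^sup>2) ^ 3) (at p)"
proof -
  have "1 + p\<^sup>2 > 0"
    by (simp add: add_pos_nonneg)
  then show ?thesis
    unfolding velocity_def
    by (auto intro!: derivative_eq_intros)
      (simp add: field_simps power2_eq_square power3_eq_cube)
qed

lemma continuous_on_velocity [continuous_intros]:
  "continuous_on S h \<Longrightarrow> continuous_on S (\<lambda>x. velocity (h x))"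
  by (rule continuous_on_compose2[of UNIV velocity])
    (auto intro!: DERIV_continuous_on velocity_has_real_derivative[THEN DERIV_subset])

lemma velocity_neg_iff: "velocity p < 0 \<longleftrightarrow> p < 0"
  using sqrt_one_plus_square_pos[of p] by (simp add: velocity_def divide_less_0_iff)

lemma abs_velocity_less_one: "\<bar>velocity p\<bar> < 1"
proof -
  have "\<bar>p\<bar> = sqrt (p\<^sup>2)" by simp
  also have "\<dots> < sqrt (1 + p\<^sup>2)" by (rule real_sqrt_less_mono) simp
  finally show ?thesis
    using sqrt_one_plus_square_pos[of p] by (simp add: velocity_def)
qed

lemma abs_velocity_le: "\<bar>velocity p\<bar> \<le> \<bar>p\<bar>"
proof -
  have "1 \<le> sqrt (1 + p\<^sup>2)" by simp
  then have "\<bar>p\<bar> / sqrt (1 + p\<^sup>2) \<le> \<bar>p\<bar> / 1"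
    by (intro divide_left_mono) (use sqrt_one_plus_square_pos[of p] in auto)
  then show ?thesis
    using sqrt_one_plus_square_pos[of p] by (simp add: velocity_def)
qed

lemma velocity_lipschitz: "\<bar>velocity p - velocity q\<bar> \<le> \<bar>p - q\<bar>"
proof -
  have "norm (velocity p - velocity q) \<le> 1 * norm (p - q)"
  proof (rule field_differentiable_bound[where S=UNIV])
    fix z :: real
    show "(velocity has_field_derivative 1 / sqrt (1 + z\<^sup>2) ^ 3) (at z within UNIV)"
      using velocity_has_real_derivative by simp
    have "1 \<le> sqrt (1 + z\<^sup>2) ^ 3" by (rule one_le_power) simp
    then show "norm (1 / sqrt (1 + z\<^sup>2) ^ 3) \<le> 1"
      using zero_less_power[OF sqrt_one_plus_square_pos[of z], of 3]
      by (simp only: real_norm_def abs_divide abs_one abs_of_pos divide_le_eq_1) auto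
  qed auto
  then show ?thesis by simp
qed

lemma sqrt_one_plus_square_has_real_derivative:
  "((\<lambda>p. sqrt (1 + p\<^sup>2)) has_real_derivative velocity p) (at p)"
proof -
  have "1 + p\<^sup>2 > 0" by (simp add: add_pos_nonneg)
  then show ?thesis
    unfolding velocity_def by (auto intro!: derivative_eq_intros simp: divide_simps)
qed

text \<open>
  The quotient form of the derivative, valid also for \<open>m = 0\<close>, is the one that produces the
  friction term \<open>m / r\<close>.
\<close>

lemma power_has_real_derivative:
  fixes r :: real
  assumes "r > 0"
  shows "((\<lambda>s. s ^ m) has_real_derivative real m * r ^ m / r) (at r)"
  using assms by (cases m) (auto intro!: derivative_eq_intros simp del: power_Suc, simp)

text \<open>
  The exponent \<open>m\<close> stands for the dimension minus one. The bound \<open>L \<ge> 1\<close> serves to let \<open>L\<close> itself be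
  the rate of the exponential weight below, which has to dominate linear growth.
\<close>

locale radial_ivp =
  fixes g :: "real \<Rightarrow> real" and L B :: real and m :: nat
  assumes lipschitz: "\<bar>g x - g y\<bar> \<le> L * \<bar>x - y\<bar>"
    and L_ge_1: "L \<ge> 1"
    and bounded: "\<bar>g x\<bar> \<le> B"
begin

lemma B_nonneg: "B \<ge> 0"
  using bounded[of 0] by linarith

lemma continuous_on_g [continuous_intros]:
  "continuous_on S h \<Longrightarrow> continuous_on S (\<lambda>x. g (h x))"
proof (rule continuous_on_compose2[of UNIV g])
  have "L-lipschitz_on UNIV g"
    using lipschitz L_ge_1 by (auto simp: lipschitz_on_def dist_real_def)
  then show "continuous_on UNIV g" by (rule lipschitz_on_continuous_on)
qed auto

text \<open>
  The solution of \<open>(r ^ m * w)' = - r ^ m * g (u r)\<close> with \<open>w 0 = 0\<close>. Keeping the power inside the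
  integral as \<open>(t / r) ^ m \<le> 1\<close> makes all estimates uniform up to \<open>r = 0\<close>.
\<close>

definition flux :: "(real \<Rightarrow> real) \<Rightarrow> real \<Rightarrow> real"
  where "flux u r = - integral {0..r} (\<lambda>t. (t / r) ^ m * g (u t))"

lemma flux_0 [simp]: "flux u 0 = 0"
  by (simp add: flux_def)

lemma abs_flux_diff_le:
  assumes "continuous_on UNIV u" "continuous_on UNIV v" "r \<ge> 0"
    and D: "\<And>t. 0 \<le> t \<Longrightarrow> t \<le> r \<Longrightarrow> \<bar>g (u t) - g (v t)\<bar> \<le> D"
  shows "\<bar>flux u r - flux v r\<bar> \<le> D * r"
proof (cases "r = 0")
  case False
  with assms have r: "r > 0" by simp
  have cont: "continuous_on {0..r} (\<lambda>t. (t / r) ^ m * g (w t))" if "continuous_on UNIV w" for w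
    using r by (intro continuous_intros continuous_on_subset[OF that]) auto
  have "norm (integral {0..r} (\<lambda>t. (t / r) ^ m * g (u t) - (t / r) ^ m * g (v t))) \<le> D * (r - 0)"
  proof (rule integral_bound)
    fix t assume t: "t \<in> {0..r}"
    have "norm ((t / r) ^ m * g (u t) - (t / r) ^ m * g (v t)) = (t / r) ^ m * \<bar>g (u t) - g (v t)\<bar>"
      using t r by (simp add: abs_mult flip: right_diff_distrib)
    also have "\<dots> \<le> 1 * D"
      using t r D[of t] by (intro mult_mono power_le_one) auto
    finally show "norm ((t / r) ^ m * g (u t) - (t / r) ^ m * g (v t)) \<le> D" by simp
  qed (use assms cont in \<open>auto intro: continuous_on_diff\<close>)
  also have "integral {0..r} (\<lambda>t. (t / r) ^ m * g (u t) - (t / r) ^ m * g (v t))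
      = flux v r - flux u r"
    using cont assms by (subst integral_diff) (auto simp: flux_def intro!: integrable_continuous_real)
  finally show ?thesis by (simp add: abs_minus_commute)
qed simp

lemma flux_const:
  assumes "r \<ge> 0"
  shows "flux (\<lambda>_. c) r = - (g c / real (Suc m) * r)"
proof (cases "r = 0")
  case False
  with assms have r: "r > 0" by simp
  have "((\<lambda>t. (t / r) ^ m * g c) has_integral (r * (r / r) ^ Suc m / real (Suc m) * g c
      - r * (0 / r) ^ Suc m / real (Suc m) * g c)) {0..r}"
    using r
    by (intro fundamental_theorem_of_calculus)
       (auto simp flip: has_real_derivative_iff_has_vector_derivative
          intro!: derivative_eq_intros simp del: power_Suc)
  then show ?thesis using r by (auto simp: flux_def dest!: integral_unique)
qed simp

lemma abs_flux_le:
  assumes "continuous_on UNIV u" "r \<ge> 0"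
  shows "\<bar>flux u r\<bar> \<le> B * r"
proof (cases "r = 0")
  case False
  with assms have r: "r > 0" by simp
  have "norm (integral {0..r} (\<lambda>t. (t / r) ^ m * g (u t))) \<le> B * (r - 0)"
  proof (rule integral_bound)
    show "continuous_on {0..r} (\<lambda>t. (t / r) ^ m * g (u t))"
      using r by (intro continuous_intros continuous_on_subset[OF assms(1)]) auto
    fix t assume t: "t \<in> {0..r}"
    have "norm ((t / r) ^ m * g (u t)) \<le> 1 * B"
      using t r bounded[of "u t"]
      by (simp only: real_norm_def abs_mult, intro mult_mono) (auto intro!: power_le_one)
    then show "norm ((t / r) ^ m * g (u t)) \<le> B" by simp
  qed (use r in auto)
  then show ?thesis by (simp add: flux_def)
qed simp

lemma flux_has_real_derivative:
  assumes u: "continuous_on UNIV u" and r: "r > 0"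
  shows "(flux u has_real_derivative - g (u r) - real m / r * flux u r) (at r)"
proof -
  define P where "P = (\<lambda>s. integral {0..s} (\<lambda>t. t ^ m * g (u t)))"
  have flux: "flux u s = - (P s / s ^ m)" for s
    unfolding flux_def P_def
    by (simp add: power_divide flip: integral_divide)
  have "(P has_real_derivative r ^ m * g (u r)) (at r within {0..r+1})"
    unfolding P_def using r
    by (intro integral_has_real_derivative continuous_intros continuous_on_subset[OF u]) auto
  then have P: "(P has_real_derivative r ^ m * g (u r)) (at r)"
    using r by (simp add: at_within_Icc_at)
  have "((\<lambda>s. - (P s / s ^ m)) has_real_derivative - g (u r) - real m / r * flux u r) (at r)"
    by (rule DERIV_cong[OF DERIV_minus[OF DERIV_divide[OF P power_has_real_derivative[OF r]]]])
      (use r in \<open>auto simp: flux field_simps\<close>)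
  then show ?thesis by (simp add: flux[abs_def])
qed

lemma continuous_on_flux:
  assumes u: "continuous_on UNIV u"
  shows "continuous_on {0..} (flux u)"
proof -
  have "continuous (at r within {0..}) (flux u)" if "r \<ge> 0" for r
  proof (cases "r = 0")
    case False
    then show ?thesis
      using that flux_has_real_derivative[OF u, of r]
      by (auto intro: continuous_at_imp_continuous_at_within DERIV_isCont)
  next
    case True
    have "(flux u \<longlongrightarrow> 0) (at 0 within {0..})"
    proof (rule Lim_null_comparison)
      show "\<forall>\<^sub>F r in at 0 within {0..}. norm (flux u r) \<le> B * r"
        using abs_flux_le[OF u] by (auto simp: eventually_at_filter)
      show "((\<lambda>r. B * r) \<longlongrightarrow> 0) (at 0 within {0..})"
        by (auto intro!: tendsto_eq_intros)
    qed
    then show ?thesis by (simp add: True continuous_within)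
  qed
  then show ?thesis by (simp add: continuous_on_eq_continuous_within)
qed

text \<open>
  The absolute value extends the map evenly to the whole line, on which bounded continuous
  functions form a complete space.
\<close>

definition integral_step :: "real \<Rightarrow> (real \<Rightarrow> real) \<Rightarrow> real \<Rightarrow> real"
  where "integral_step \<xi> u r = \<xi> + integral {0..\<bar>r\<bar>} (\<lambda>s. velocity (flux u s))"

lemma continuous_on_velocity_flux:
  assumes "continuous_on UNIV u"
  shows "continuous_on {0..r} (\<lambda>s. velocity (flux u s))"
  by (intro continuous_intros continuous_on_subset[OF continuous_on_flux[OF assms]]) auto

lemma continuous_on_integral_step:
  assumes u: "continuous_on UNIV u"
  shows "continuous_on UNIV (integral_step \<xi> u)"
proof -
  have "isCont (integral_step \<xi> u) r" for r
  proof -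
    define b where "b = \<bar>r\<bar> + 1"
    have "continuous_on {0..b} (\<lambda>x. integral {0..x} (\<lambda>s. velocity (flux u s)))"
      by (intro indefinite_integral_continuous_1 integrable_continuous_real
          continuous_on_velocity_flux u)
    then have "continuous_on {-b<..<b} (integral_step \<xi> u)"
      unfolding integral_step_def
      by (intro continuous_intros) (rule continuous_on_compose2, auto intro!: continuous_intros)
    then show ?thesis
      by (rule continuous_on_interior) (auto simp: b_def)
  qed
  then show ?thesis by (simp add: continuous_at_imp_continuous_on)
qed

lemma abs_integral_velocity_le:
  assumes u: "continuous_on UNIV u" and "0 \<le> r"
  shows "\<bar>integral {0..r} (\<lambda>s. velocity (flux u s))\<bar> \<le> r"
proof -
  have "norm (integral {0..r} (\<lambda>s. velocity (flux u s))) \<le> 1 * (r - 0)"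
    using assms abs_velocity_less_one
    by (intro integral_bound continuous_on_velocity_flux) (auto simp: less_imp_le)
  then show ?thesis by simp
qed

lemma integral_step_bcontfun:
  assumes u: "continuous_on UNIV u"
  shows "(\<lambda>r. exp (- L * r\<^sup>2) * integral_step \<xi> u r) \<in> bcontfun"
proof (rule bcontfun_normI)
  show "continuous_on UNIV (\<lambda>r. exp (- L * r\<^sup>2) * integral_step \<xi> u r)"
    by (intro continuous_intros continuous_on_integral_step u)
  fix r :: real
  have "0 \<le> (\<bar>r\<bar> - 1)\<^sup>2" by simp
  then have "\<bar>r\<bar> \<le> 1 + r\<^sup>2"
    by (simp add: power2_diff)
  also have "\<dots> \<le> 1 + L * r\<^sup>2"
    using L_ge_1 by (simp add: mult_le_cancel_right1)
  also have "\<dots> \<le> exp (L * r\<^sup>2)" by (rule exp_ge_add_one_self)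
  finally have "exp (- L * r\<^sup>2) * \<bar>r\<bar> \<le> 1"
    by (simp add: exp_minus field_simps)
  moreover have "exp (- L * r\<^sup>2) * \<bar>\<xi>\<bar> \<le> 1 * \<bar>\<xi>\<bar>"
    using L_ge_1 by (intro mult_right_mono) auto
  moreover have "\<bar>integral_step \<xi> u r\<bar> \<le> \<bar>\<xi>\<bar> + \<bar>r\<bar>"
    using abs_integral_velocity_le[OF u, of "\<bar>r\<bar>"] by (simp add: integral_step_def)
  then have "exp (- L * r\<^sup>2) * \<bar>integral_step \<xi> u r\<bar> \<le> exp (- L * r\<^sup>2) * (\<bar>\<xi>\<bar> + \<bar>r\<bar>)"
    by (rule mult_left_mono) simp
  ultimately show "norm (exp (- L * r\<^sup>2) * integral_step \<xi> u r) \<le> \<bar>\<xi>\<bar> + 1"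
    by (simp add: abs_mult distrib_left)
qed

text \<open>
  The contraction acts on \<open>exp (- L * r\<^sup>2) * u r\<close> instead of \<open>u\<close>, so that one fixed point covers
  all radii at once.
\<close>

definition unweight :: "(real \<Rightarrow>\<^sub>C real) \<Rightarrow> real \<Rightarrow> real"
  where "unweight z r = exp (L * r\<^sup>2) * apply_bcontfun z r"

lemma continuous_on_unweight: "continuous_on UNIV (unweight z)"
  unfolding unweight_def by (intro continuous_intros) auto

definition picard :: "real \<Rightarrow> (real \<Rightarrow>\<^sub>C real) \<Rightarrow> (real \<Rightarrow>\<^sub>C real)"
  where "picard \<xi> z = Bcontfun (\<lambda>r. exp (- L * r\<^sup>2) * integral_step \<xi> (unweight z) r)"

lemma apply_picard:
  "apply_bcontfun (picard \<xi> z) r = exp (- L * r\<^sup>2) * integral_step \<xi> (unweight z) r"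
  unfolding picard_def
  by (subst Bcontfun_inverse) (rule integral_step_bcontfun[OF continuous_on_unweight], simp)

lemma integral_exp_square:
  assumes "r \<ge> 0"
  shows "((\<lambda>s. L * exp (L * s\<^sup>2) * s) has_integral (exp (L * r\<^sup>2) - 1) / 2) {0..r}"
proof -
  have "((\<lambda>s. L * exp (L * s\<^sup>2) * s) has_integral
      (exp (L * r\<^sup>2) / 2 - exp (L * 0\<^sup>2) / 2)) {0..r}"
    using assms
    by (intro fundamental_theorem_of_calculus)
      (auto simp flip: has_real_derivative_iff_has_vector_derivative intro!: derivative_eq_intros)
  then show ?thesis by (simp add: diff_divide_distrib)
qed

text \<open>
  A difference of weighted size \<open>d\<close> changes the flux at radius \<open>s\<close> by at most
  \<open>L * s * exp (L * s\<^sup>2) * d\<close>, and the integral of \<open>L * s * exp (L * s\<^sup>2)\<close> is half of the inverse weight: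
  this is the contraction factor \<open>1/2\<close>. The initial values are allowed to differ so that the same
  estimate yields dependence on them.
\<close>

lemma dist_picard_le: "dist (picard \<xi> z) (picard \<eta> y) \<le> \<bar>\<xi> - \<eta>\<bar> + dist z y / 2"
proof (rule dist_bound)
  fix r :: real
  define d where "d = dist z y"
  define R where "R = \<bar>r\<bar>"
  have R: "R \<ge> 0" "R\<^sup>2 = r\<^sup>2" by (auto simp: R_def)
  have d: "d \<ge> 0" by (simp add: d_def)
  let ?V = "\<lambda>z s. velocity (flux (unweight z) s)"
  have V: "?V z integrable_on {0..R}" for z
    by (intro integrable_continuous_real continuous_on_velocity_flux continuous_on_unweight)
  have "norm (integral {0..R} (\<lambda>s. ?V z s - ?V y s)) \<le>
      integral {0..R} (\<lambda>s. L * exp (L * s\<^sup>2) * s * d)"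
  proof (rule integral_norm_bound_integral)
    show "(\<lambda>s. ?V z s - ?V y s) integrable_on {0..R}"
      by (intro integrable_diff V)
    show "(\<lambda>s. L * exp (L * s\<^sup>2) * s * d) integrable_on {0..R}"
      by (intro integrable_continuous_real continuous_intros)
    fix s assume s: "s \<in> {0..R}"
    have "norm (?V z s - ?V y s) \<le> \<bar>flux (unweight z) s - flux (unweight y) s\<bar>"
      using velocity_lipschitz by simp
    also have "\<dots> \<le> L * (exp (L * s\<^sup>2) * d) * s"
    proof (rule abs_flux_diff_le)
      fix t assume t: "0 \<le> t" "t \<le> s"
      have "\<bar>unweight z t - unweight y t\<bar> = exp (L * t\<^sup>2) * dist (apply_bcontfun z t) (apply_bcontfun y t)"
        by (simp add: unweight_def dist_real_def abs_mult flip: right_diff_distrib)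
      also have "\<dots> \<le> exp (L * s\<^sup>2) * d"
        using t L_ge_1 d
        by (intro mult_mono) (auto simp: d_def dist_bounded intro!: power_mono)
      finally have "L * \<bar>unweight z t - unweight y t\<bar> \<le> L * (exp (L * s\<^sup>2) * d)"
        using L_ge_1 by simp
      then show "\<bar>g (unweight z t) - g (unweight y t)\<bar> \<le> L * (exp (L * s\<^sup>2) * d)"
        using lipschitz[of "unweight z t" "unweight y t"] by linarith
    qed (use s in \<open>auto intro: continuous_on_unweight\<close>)
    finally show "norm (?V z s - ?V y s) \<le> L * exp (L * s\<^sup>2) * s * d"
      by (simp add: mult_ac)
  qed
  also have "\<dots> = (exp (L * r\<^sup>2) - 1) / 2 * d"
    using integral_unique[OF has_integral_mult_left[OF integral_exp_square[OF R(1)], of d]] R(2)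
    by simp
  also have "\<dots> \<le> exp (L * r\<^sup>2) * (d / 2)"
    using d by (simp add: algebra_simps)
  also have "integral {0..R} (\<lambda>s. ?V z s - ?V y s) = integral {0..R} (?V z) - integral {0..R} (?V y)"
    by (intro integral_diff V)
  finally have "exp (- L * r\<^sup>2) * \<bar>integral {0..R} (?V z) - integral {0..R} (?V y)\<bar> \<le> d / 2"
    by (simp add: exp_minus field_simps)
  moreover have "exp (- L * r\<^sup>2) * \<bar>\<xi> - \<eta>\<bar> \<le> 1 * \<bar>\<xi> - \<eta>\<bar>"
    using L_ge_1 by (intro mult_right_mono) auto
  moreover have "dist (apply_bcontfun (picard \<xi> z) r) (apply_bcontfun (picard \<eta> y) r)
      = exp (- L * r\<^sup>2) * \<bar>(\<xi> - \<eta>) + (integral {0..R} (?V z) - integral {0..R} (?V y))\<bar>"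
    unfolding apply_picard dist_real_def right_diff_distrib[symmetric] abs_mult
    by (simp add: integral_step_def R_def algebra_simps)
  moreover have "\<dots> \<le> exp (- L * r\<^sup>2) *
      (\<bar>\<xi> - \<eta>\<bar> + \<bar>integral {0..R} (?V z) - integral {0..R} (?V y)\<bar>)"
    by (intro mult_left_mono abs_triangle_ineq) simp
  ultimately show "dist (apply_bcontfun (picard \<xi> z) r) (apply_bcontfun (picard \<eta> y) r)
      \<le> \<bar>\<xi> - \<eta>\<bar> + dist z y / 2"
    unfolding d_def by (simp add: distrib_left)
qed

lemma picard_fixed_point: "\<exists>!z. picard \<xi> z = z"
  using dist_picard_le[of \<xi> _ \<xi>] by (intro banach_fix_type[of "1/2"]) auto

definition weighted_profile :: "real \<Rightarrow> (real \<Rightarrow>\<^sub>C real)"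
  where "weighted_profile \<xi> = (THE z. picard \<xi> z = z)"

lemma picard_weighted_profile: "picard \<xi> (weighted_profile \<xi>) = weighted_profile \<xi>"
  unfolding weighted_profile_def by (rule theI'[OF picard_fixed_point])

definition profile :: "real \<Rightarrow> real \<Rightarrow> real"
  where "profile \<xi> = unweight (weighted_profile \<xi>)"

lemma continuous_on_profile_UNIV: "continuous_on UNIV (profile \<xi>)"
  by (simp add: profile_def continuous_on_unweight)

lemma continuous_on_profile [continuous_intros]:
  "continuous_on S h \<Longrightarrow> continuous_on S (\<lambda>x. profile \<xi> (h x))"
  by (rule continuous_on_compose2[OF continuous_on_profile_UNIV]) auto

lemma profile_eq: "profile \<xi> r = integral_step \<xi> (profile \<xi>) r"
proof -
  have "profile \<xi> r = exp (L * r\<^sup>2) * (exp (- L * r\<^sup>2) * integral_step \<xi> (profile \<xi>) r)"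
    unfolding profile_def
    by (subst (1) unweight_def, subst (1) picard_weighted_profile[symmetric]) (simp add: apply_picard)
  then show ?thesis by (simp add: exp_minus)
qed

lemma profile_0 [simp]: "profile \<xi> 0 = \<xi>"
  by (subst profile_eq) (simp add: integral_step_def)

lemma abs_profile_diff_le: "\<bar>profile \<xi> r - profile \<eta> r\<bar> \<le> 2 * exp (L * r\<^sup>2) * \<bar>\<xi> - \<eta>\<bar>"
proof -
  let ?d = "dist (weighted_profile \<xi>) (weighted_profile \<eta>)"
  have "?d \<le> \<bar>\<xi> - \<eta>\<bar> + ?d / 2"
    using dist_picard_le[of \<xi> "weighted_profile \<xi>" \<eta> "weighted_profile \<eta>"]
    by (simp add: picard_weighted_profile)
  then have "?d \<le> 2 * \<bar>\<xi> - \<eta>\<bar>" by simp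
  then have "dist (apply_bcontfun (weighted_profile \<xi>) r) (apply_bcontfun (weighted_profile \<eta>) r)
      \<le> 2 * \<bar>\<xi> - \<eta>\<bar>"
    using dist_bounded[of "weighted_profile \<xi>" r "weighted_profile \<eta>"] by linarith
  then have "exp (L * r\<^sup>2) * dist (apply_bcontfun (weighted_profile \<xi>) r)
      (apply_bcontfun (weighted_profile \<eta>) r) \<le> exp (L * r\<^sup>2) * (2 * \<bar>\<xi> - \<eta>\<bar>)"
    by (rule mult_left_mono) simp
  then show ?thesis
    by (simp add: profile_def unweight_def dist_real_def abs_mult mult.assoc mult.left_commute
        flip: right_diff_distrib)
qed

text \<open>
  The constant function is a fixed point of the contraction, so uniqueness identifies it with the profile.
\<close>

lemma profile_equilibrium:
  assumes "g c = 0"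
  shows "profile c r = c"
proof -
  have const: "integral_step c (\<lambda>_. c) r = c" for r
  proof -
    have "integral {0..\<bar>r\<bar>} (\<lambda>s. velocity (flux (\<lambda>_. c) s)) = integral {0..\<bar>r\<bar>} (\<lambda>s. 0)"
      by (rule integral_cong) (simp add: flux_const assms velocity_def)
    then show ?thesis by (simp add: integral_step_def)
  qed
  define z where "z = Bcontfun (\<lambda>r. exp (- L * r\<^sup>2) * c)"
  have z: "apply_bcontfun z r = exp (- L * r\<^sup>2) * c" for r
    using integral_step_bcontfun[of "\<lambda>_. c" c]
    by (simp add: z_def Bcontfun_inverse const)
  then have unweight: "unweight z = (\<lambda>_. c)"
    by (auto simp: unweight_def exp_minus)
  have "picard c z = z"
    by (rule bcontfun_eqI) (simp only: apply_picard unweight const z)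
  then have "weighted_profile c = z"
    using picard_fixed_point[of c] picard_weighted_profile[of c] by blast
  then show ?thesis by (simp add: profile_def unweight)
qed

definition momentum :: "real \<Rightarrow> real \<Rightarrow> real"
  where "momentum \<xi> = flux (profile \<xi>)"

lemma momentum_0 [simp]: "momentum \<xi> 0 = 0"
  by (simp add: momentum_def)

lemma continuous_on_momentum [continuous_intros]:
  assumes "continuous_on S h" "\<And>x. x \<in> S \<Longrightarrow> h x \<ge> 0"
  shows "continuous_on S (\<lambda>x. momentum \<xi> (h x))"
  unfolding momentum_def
  by (rule continuous_on_compose2[OF continuous_on_flux[OF continuous_on_profile_UNIV] assms(1)])
    (use assms(2) in auto)

lemma profile_has_real_derivative:
  assumes "r > 0"
  shows "(profile \<xi> has_real_derivative velocity (momentum \<xi> r)) (at r)"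
proof -
  have "((\<lambda>x. integral {0..x} (\<lambda>s. velocity (flux (profile \<xi>) s))) has_real_derivative
      velocity (flux (profile \<xi>) r)) (at r within {0..r + 1})"
    using assms
    by (intro integral_has_real_derivative continuous_on_velocity_flux continuous_on_profile_UNIV) auto
  then have "((\<lambda>x. \<xi> + integral {0..x} (\<lambda>s. velocity (flux (profile \<xi>) s))) has_real_derivative
      velocity (momentum \<xi> r)) (at r)"
    using assms by (auto intro!: derivative_eq_intros simp: momentum_def at_within_Icc_at)
  then show ?thesis
  proof (rule has_field_derivative_transform_within[where d=r])
    fix x assume "dist x r < r"
    then have "x \<ge> 0" by (simp add: dist_real_def)
    then show "\<xi> + integral {0..x} (\<lambda>s. velocity (flux (profile \<xi>) s)) = profile \<xi> x"
      by (subst profile_eq) (simp add: integral_step_def)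
  qed (use assms in auto)
qed

lemma momentum_has_real_derivative:
  assumes "r > 0"
  shows "(momentum \<xi> has_real_derivative
    - g (profile \<xi> r) - real m / r * momentum \<xi> r) (at r)"
  unfolding momentum_def by (rule flux_has_real_derivative[OF continuous_on_profile_UNIV assms])

lemma profile_strict_decreasing:
  assumes "0 \<le> a" "a < b" "\<And>s. a < s \<Longrightarrow> s < b \<Longrightarrow> momentum \<xi> s < 0"
  shows "profile \<xi> b < profile \<xi> a"
proof (rule DERIV_neg_imp_decreasing_open[OF \<open>a < b\<close>])
  fix x assume x: "a < x" "x < b"
  then show "\<exists>y. (profile \<xi> has_real_derivative y) (at x) \<and> y < 0"
    using profile_has_real_derivative[of x \<xi>] assms
    by (intro exI[of _ "velocity (momentum \<xi> x)"]) (auto simp: velocity_neg_iff)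
qed (rule continuous_intros continuous_on_id)+

lemma abs_profile_diff_initial_le:
  assumes "r \<ge> 0"
  shows "\<bar>profile \<xi> r - \<xi>\<bar> \<le> r"
  using abs_integral_velocity_le[OF continuous_on_profile_UNIV assms, of \<xi>] assms
  by (subst profile_eq) (simp add: integral_step_def)

text \<open>
  Near the origin the momentum is that of the constant nonlinearity \<open>g \<xi>\<close>, because the profile moves
  with velocity less than \<open>1\<close>. This fixes the sign of the momentum and the limit of \<open>momentum / r\<close> there.
\<close>

lemma abs_momentum_plus_le:
  assumes "r \<ge> 0"
  shows "\<bar>momentum \<xi> r + g \<xi> / real (Suc m) * r\<bar> \<le> L * r * r"
proof -
  have "\<bar>flux (profile \<xi>) r - flux (\<lambda>_. \<xi>) r\<bar> \<le> (L * r) * r"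
  proof (rule abs_flux_diff_le)
    fix t assume t: "0 \<le> t" "t \<le> r"
    have "\<bar>g (profile \<xi> t) - g \<xi>\<bar> \<le> L * \<bar>profile \<xi> t - \<xi>\<bar>" by (rule lipschitz)
    also have "\<dots> \<le> L * r"
      using abs_profile_diff_initial_le[OF t(1), of \<xi>] t L_ge_1 by (intro mult_left_mono) auto
    finally show "\<bar>g (profile \<xi> t) - g \<xi>\<bar> \<le> L * r" .
  qed (use assms in \<open>auto intro: continuous_on_profile_UNIV\<close>)
  then show ?thesis
    using assms by (simp add: momentum_def flux_const)
qed

lemma abs_momentum_diff_le:
  assumes "r \<ge> 0"
  shows "\<bar>momentum \<xi> r - momentum \<eta> r\<bar> \<le> L * (2 * exp (L * r\<^sup>2) * \<bar>\<xi> - \<eta>\<bar>) * r"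
  unfolding momentum_def
proof (rule abs_flux_diff_le)
  fix t assume t: "0 \<le> t" "t \<le> r"
  have "\<bar>g (profile \<xi> t) - g (profile \<eta> t)\<bar> \<le> L * \<bar>profile \<xi> t - profile \<eta> t\<bar>" by (rule lipschitz)
  also have "\<bar>profile \<xi> t - profile \<eta> t\<bar> \<le> 2 * exp (L * t\<^sup>2) * \<bar>\<xi> - \<eta>\<bar>"
    by (rule abs_profile_diff_le)
  also have "\<dots> \<le> 2 * exp (L * r\<^sup>2) * \<bar>\<xi> - \<eta>\<bar>"
    using t L_ge_1 by (intro mult_right_mono) (auto intro!: power_mono)
  finally show "\<bar>g (profile \<xi> t) - g (profile \<eta> t)\<bar> \<le> L * (2 * exp (L * r\<^sup>2) * \<bar>\<xi> - \<eta>\<bar>)"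
    using L_ge_1 by simp
qed (use assms in \<open>auto intro: continuous_on_profile_UNIV\<close>)

lemma continuous_on_profile_initial: "continuous_on UNIV (\<lambda>\<xi>. profile \<xi> r)"
proof (rule lipschitz_on_continuous_on)
  show "(2 * exp (L * r\<^sup>2))-lipschitz_on UNIV (\<lambda>\<xi>. profile \<xi> r)"
    using abs_profile_diff_le by (auto simp: lipschitz_on_def dist_real_def)
qed

lemma continuous_on_momentum_initial:
  assumes "r \<ge> 0"
  shows "continuous_on UNIV (\<lambda>\<xi>. momentum \<xi> r)"
proof (rule lipschitz_on_continuous_on)
  show "(L * (2 * exp (L * r\<^sup>2)) * r)-lipschitz_on UNIV (\<lambda>\<xi>. momentum \<xi> r)"
    using abs_momentum_diff_le[OF assms] L_ge_1 assms
    by (auto simp: lipschitz_on_def dist_real_def mult_ac)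
qed

end

section \<open>Energy and shooting\<close>

lemma first_crossing:
  fixes h :: "real \<Rightarrow> real"
  assumes "continuous_on {a..b} h" "a \<le> b" "h a < c" "c \<le> h b"
  obtains t where "a < t" "t \<le> b" "h t = c" "\<And>s. a \<le> s \<Longrightarrow> s < t \<Longrightarrow> h s < c"
proof -
  let ?S = "{a..b} \<inter> h -` {c..}"
  have "closed ?S"
    by (intro continuous_closed_preimage assms) auto
  then have "compact ?S"
    using compact_Int_closed[of "{a..b}" ?S] by (simp add: Int_absorb1)
  moreover have "b \<in> ?S" using assms by auto
  ultimately obtain t where t: "t \<in> ?S" "\<And>s. s \<in> ?S \<Longrightarrow> t \<le> s"
    using compact_attains_inf[of ?S] by blast
  have below: "h s < c" if "a \<le> s" "s < t" for s
    using t(2)[of s] t(1) that by force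
  have "a < t" using t(1) assms(3) by (cases "a = t") auto
  moreover have "h t = c"
  proof (rule ccontr)
    assume "h t \<noteq> c"
    then have "c < h t" using t(1) by auto
    moreover have "continuous_on {a..t} h"
      using assms(1) t(1) by (auto intro: continuous_on_subset)
    ultimately obtain s where "a \<le> s" "s \<le> t" "h s = c"
      using IVT'[of h a c t] assms(3) \<open>a < t\<close> by auto
    with below[of s] \<open>h t \<noteq> c\<close> show False by (cases "s = t") auto
  qed
  ultimately show thesis using that t(1) below by auto
qed

lemma antimono_bounded_tendsto_at_top:
  fixes h :: "real \<Rightarrow> real"
  assumes anti: "\<And>a b. 0 \<le> a \<Longrightarrow> a \<le> b \<Longrightarrow> h b \<le> h a" and low: "\<And>r. 0 \<le> r \<Longrightarrow> c \<le> h r"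
  obtains l where "(h \<longlongrightarrow> l) at_top" "\<And>r. 0 \<le> r \<Longrightarrow> l \<le> h r" "c \<le> l"
proof -
  define l where "l = Inf (h ` {0..})"
  have bdd: "bdd_below (h ` {0..})" using low by (auto intro!: bdd_belowI[of _ c])
  have le: "l \<le> h r" if "0 \<le> r" for r
    unfolding l_def using that bdd by (auto intro: cInf_lower)
  have "(h \<longlongrightarrow> l) at_top"
  proof (rule decreasing_tendsto)
    show "\<forall>\<^sub>F r in at_top. l \<le> h r"
      using eventually_ge_at_top[of 0] by eventually_elim (rule le)
    fix y assume "l < y"
    then obtain r where r: "0 \<le> r" "h r < y"
      using cInf_less_iff[of "h ` {0..}" y] bdd by (auto simp: l_def)
    show "\<forall>\<^sub>F r in at_top. h r < y"
      using eventually_ge_at_top[of r] by eventually_elim (use anti r in force)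
  qed
  moreover have "c \<le> l"
    unfolding l_def using low by (intro cInf_greatest) auto
  ultimately show thesis using that le by blast
qed

text \<open>
  By the mean value theorem \<open>h (r + 1) - h r\<close> is a value of \<open>h'\<close> beyond \<open>r\<close>.
\<close>

lemma derivative_tendsto_zero:
  fixes h :: "real \<Rightarrow> real"
  assumes "(h \<longlongrightarrow> l) at_top" "(h' \<longlongrightarrow> d) at_top"
    and deriv: "\<And>r. r > 0 \<Longrightarrow> (h has_real_derivative h' r) (at r)"
  shows "d = 0"
proof -
  have "\<exists>z. r < z \<and> z < r + 1 \<and> h (r + 1) - h r = h' z" if "r > 0" for r
    using MVT2[of r "r + 1" h h'] deriv that by force
  then obtain z where z: "\<And>r. r > 0 \<Longrightarrow> r < z r \<and> h (r + 1) - h r = h' (z r)"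
    by metis
  have "filterlim z at_top at_top"
    by (rule filterlim_at_top_mono[OF filterlim_ident])
      (use eventually_gt_at_top[of 0] in eventually_elim, use z in \<open>auto intro: less_imp_le\<close>)
  then have "((\<lambda>r. h' (z r)) \<longlongrightarrow> d) at_top"
    by (rule filterlim_compose[OF assms(2)])
  moreover have "filterlim (\<lambda>r::real. r + 1) at_top at_top"
    by (rule filterlim_at_top_mono[OF filterlim_ident]) (simp add: eventually_at_top_linorder)
  then have "((\<lambda>r. h (r + 1) - h r) \<longlongrightarrow> l - l) at_top"
    by (intro tendsto_diff filterlim_compose[OF assms(1)] assms(1))
  then have "((\<lambda>r. h' (z r)) \<longlongrightarrow> l - l) at_top"
    by (rule tendsto_cong[THEN iffD1, rotated])
      (use eventually_gt_at_top[of 0] in eventually_elim, use z in auto)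
  ultimately show ?thesis
    using tendsto_unique[OF trivial_limit_at_top_linorder] by fastforce
qed

text \<open>
  What the shooting argument needs to know about the nonlinearity. Here \<open>G\<close> is the primitive that vanishes
  on the negative half line, and all profiles of interest start in \<open>[\<xi>\<^sub>0, M)\<close>.
\<close>

locale ground_state_shooting = radial_ivp +
  fixes G :: "real \<Rightarrow> real" and \<xi>\<^sub>0 M :: real
  assumes m_pos: "m \<ge> 1"
    and G_has_real_derivative: "(G has_real_derivative g s) (at s)"
    and g_nonpos: "s \<le> 0 \<Longrightarrow> g s = 0"
    and G_nonpos: "s \<le> 0 \<Longrightarrow> G s = 0"
    and \<xi>\<^sub>0_pos: "0 < \<xi>\<^sub>0"
    and G_neg: "0 < s \<Longrightarrow> s < \<xi>\<^sub>0 \<Longrightarrow> G s < 0"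
    and G_\<xi>\<^sub>0: "G \<xi>\<^sub>0 = 0"
    and g_pos: "\<xi>\<^sub>0 \<le> s \<Longrightarrow> s < M \<Longrightarrow> 0 < g s"
begin

lemma continuous_on_G [continuous_intros]:
  "continuous_on S h \<Longrightarrow> continuous_on S (\<lambda>x. G (h x))"
  by (rule continuous_on_compose2[of UNIV G])
    (auto intro!: DERIV_continuous_on G_has_real_derivative[THEN DERIV_subset])

lemma G_less:
  assumes "\<xi>\<^sub>0 \<le> s" "s < t" "t < M"
  shows "G s < G t"
proof (rule DERIV_pos_imp_increasing[OF \<open>s < t\<close>])
  fix x assume "s \<le> x" "x \<le> t"
  then show "\<exists>y. (G has_real_derivative y) (at x) \<and> 0 < y"
    using G_has_real_derivative g_pos assms by (intro exI[of _ "g x"]) auto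
qed

text \<open>
  Kinetic plus potential energy of the relativistic oscillator: \<open>sqrt (1 + p\<^sup>2) - 1\<close> is the primitive
  of \<^const>\<open>velocity\<close> that vanishes at \<open>0\<close>.
\<close>

definition energy :: "real \<Rightarrow> real \<Rightarrow> real"
  where "energy \<xi> r = sqrt (1 + (momentum \<xi> r)\<^sup>2) - 1 + G (profile \<xi> r)"

lemma energy_0: "energy \<xi> 0 = G \<xi>"
  by (simp add: energy_def)

lemma G_le_energy: "G (profile \<xi> r) \<le> energy \<xi> r"
  by (simp add: energy_def)

lemma continuous_on_energy: "continuous_on {0..} (energy \<xi>)"
  unfolding energy_def by (intro continuous_intros) auto

lemma continuous_on_energy_Icc: "0 \<le> a \<Longrightarrow> continuous_on {a..b} (energy \<xi>)"
  by (rule continuous_on_subset[OF continuous_on_energy]) auto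

lemma energy_has_real_derivative:
  assumes "r > 0"
  shows "(energy \<xi> has_real_derivative
    - (real m / r * (velocity (momentum \<xi> r) * momentum \<xi> r))) (at r)"
proof -
  have "((\<lambda>r. sqrt (1 + (momentum \<xi> r)\<^sup>2) - 1 + G (profile \<xi> r)) has_real_derivative
      velocity (momentum \<xi> r) * (- g (profile \<xi> r) - real m / r * momentum \<xi> r) - 0
      + g (profile \<xi> r) * velocity (momentum \<xi> r)) (at r)"
    using assms
    by (intro DERIV_add DERIV_diff DERIV_const
        DERIV_chain2[OF sqrt_one_plus_square_has_real_derivative]
        DERIV_chain2[OF G_has_real_derivative]
        momentum_has_real_derivative profile_has_real_derivative)
  then show ?thesis
    unfolding energy_def[abs_def] by (rule DERIV_cong) (simp add: algebra_simps)
qed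

lemma velocity_times_nonneg: "velocity p * p \<ge> 0"
  using sqrt_one_plus_square_pos[of p] by (simp add: velocity_def)

lemma energy_antimono:
  assumes "0 \<le> r" "r \<le> s"
  shows "energy \<xi> s \<le> energy \<xi> r"
proof (rule DERIV_nonpos_imp_decreasing_open[OF \<open>r \<le> s\<close>])
  fix x assume "r < x" "x < s"
  then show "\<exists>y. (energy \<xi> has_real_derivative y) (at x) \<and> y \<le> 0"
    using assms energy_has_real_derivative[of x \<xi>] velocity_times_nonneg[of "momentum \<xi> x"]
    by (intro exI conjI) auto
qed (use assms continuous_on_energy_Icc in auto)

lemma momentum_neg_near_0:
  assumes "g \<xi> > 0"
  obtains \<delta> where "\<delta> > 0" "\<And>r. 0 < r \<Longrightarrow> r \<le> \<delta> \<Longrightarrow> momentum \<xi> r < 0"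
proof
  define \<kappa> where "\<kappa> = g \<xi> / real (Suc m)"
  have "\<kappa> > 0" unfolding \<kappa>_def by (rule divide_pos_pos[OF assms]) simp
  define \<delta> where "\<delta> = \<kappa> / (2 * L)"
  show "\<delta> > 0" using \<open>\<kappa> > 0\<close> L_ge_1 by (simp add: \<delta>_def)
  fix r assume r: "0 < r" "r \<le> \<delta>"
  have "L * r \<le> L * \<delta>" using r L_ge_1 by simp
  also have "\<dots> = \<kappa> / 2" using L_ge_1 by (simp add: \<delta>_def)
  also have "\<dots> < \<kappa>" using \<open>\<kappa> > 0\<close> by simp
  finally have "L * r * r < \<kappa> * r" using r by simp
  then show "momentum \<xi> r < 0"
    using abs_momentum_plus_le[of r \<xi>] r unfolding \<kappa>_def[symmetric] by linarith
qed

text \<open>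
  The quantity \<open>r ^ m * w r\<close> has derivative \<open>- r ^ m * g (v r)\<close> and cannot increase where \<open>g\<close> is nonnegative.
\<close>

lemma momentum_stays_neg:
  assumes "0 < a" "a \<le> b" "momentum \<xi> a < 0"
    and "\<And>s. a < s \<Longrightarrow> s < b \<Longrightarrow> 0 \<le> g (profile \<xi> s)"
  shows "momentum \<xi> b < 0"
proof -
  have "b ^ m * momentum \<xi> b \<le> a ^ m * momentum \<xi> a"
  proof (rule DERIV_nonpos_imp_decreasing_open[OF \<open>a \<le> b\<close>])
    fix x assume x: "a < x" "x < b"
    have "((\<lambda>r. r ^ m * momentum \<xi> r) has_real_derivative - (x ^ m * g (profile \<xi> x))) (at x)"
      using x assms
      by (intro DERIV_cong[OF DERIV_mult[OF power_has_real_derivative momentum_has_real_derivative]])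
        (auto simp: field_simps)
    then show "\<exists>y. ((\<lambda>r. r ^ m * momentum \<xi> r) has_real_derivative y) (at x) \<and> y \<le> 0"
      using assms x by (intro exI conjI) auto
  qed (use assms in \<open>auto intro!: continuous_intros\<close>)
  also have "\<dots> < 0" using assms by (simp add: mult_pos_neg)
  finally show ?thesis using assms by (simp add: mult_less_0_iff)
qed

text \<open>
  A Gronwall argument: with \<open>K\<close> large enough, \<open>(v\<^sup>2 + w\<^sup>2) * exp (K * r)\<close> is nondecreasing away from
  the origin, so it vanishes before any point at which it vanishes.
\<close>

lemma equilibrium_backward_unique:
  assumes "0 < a" "a \<le> b" "profile \<xi> b = 0" "momentum \<xi> b = 0"
  shows "momentum \<xi> a = 0"
proof -
  define p where "p = real m / a"
  define K where "K = 1 + L + 2 * p"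
  let ?Y = "\<lambda>r. ((profile \<xi> r)\<^sup>2 + (momentum \<xi> r)\<^sup>2) * exp (K * r)"
  have "?Y a \<le> ?Y b"
  proof (rule DERIV_nonneg_imp_nondecreasing[OF \<open>a \<le> b\<close>])
    fix r assume r: "a \<le> r" "r \<le> b"
    define q where "q = real m / r"
    define u w v where "u = profile \<xi> r" and "w = momentum \<xi> r" and "v = velocity w"
    let ?D = "2 * u * v + 2 * w * (- g u - q * w) + K * (u\<^sup>2 + w\<^sup>2)"
    have "(?Y has_real_derivative ?D * exp (K * r)) (at r)"
      using r assms unfolding u_def w_def v_def q_def
      by (auto intro!: derivative_eq_intros momentum_has_real_derivative profile_has_real_derivative
          simp: algebra_simps)
    moreover have "?D \<ge> 0"
    proof -
      have uw: "2 * (\<bar>u\<bar> * \<bar>w\<bar>) \<le> u\<^sup>2 + w\<^sup>2"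
        using zero_le_power2[of "\<bar>u\<bar> - \<bar>w\<bar>"] by (simp add: power2_diff)
      have "\<bar>u * v\<bar> \<le> \<bar>u\<bar> * \<bar>w\<bar>"
        unfolding abs_mult v_def by (intro mult_left_mono abs_velocity_le) simp
      moreover have "\<bar>g u\<bar> \<le> L * \<bar>u\<bar>"
        using lipschitz[of u 0] g_nonpos[of 0] by simp
      then have "\<bar>w * g u\<bar> \<le> L * (\<bar>u\<bar> * \<bar>w\<bar>)"
        using mult_left_mono[of "\<bar>g u\<bar>" "L * \<bar>u\<bar>" "\<bar>w\<bar>"] by (simp add: abs_mult mult_ac)
      moreover have "L * (2 * (\<bar>u\<bar> * \<bar>w\<bar>)) \<le> L * (u\<^sup>2 + w\<^sup>2)"
        using uw L_ge_1 by (intro mult_left_mono) auto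
      moreover have "q * w\<^sup>2 \<le> p * (u\<^sup>2 + w\<^sup>2)"
        using r assms unfolding p_def q_def by (intro mult_mono divide_left_mono) auto
      moreover have "2 * u * v + 2 * w * (- g u - q * w) + (1 + L + 2 * p) * (u\<^sup>2 + w\<^sup>2)
          = 2 * (u * v) - 2 * (w * g u) - 2 * (q * w\<^sup>2)
          + (u\<^sup>2 + w\<^sup>2) + L * (u\<^sup>2 + w\<^sup>2) + 2 * (p * (u\<^sup>2 + w\<^sup>2))"
        by (simp add: algebra_simps power2_eq_square)
      ultimately show ?thesis using uw unfolding K_def by linarith
    qed
    ultimately show "\<exists>y. (?Y has_real_derivative y) (at r) \<and> 0 \<le> y"
      by (intro exI[of _ "?D * exp (K * r)"]) auto
  qed
  then have "(profile \<xi> a)\<^sup>2 + (momentum \<xi> a)\<^sup>2 \<le> 0"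
    using assms by (simp add: mult_le_0_iff)
  then show ?thesis by (smt (verit) zero_le_power2 zero_eq_power2)
qed

text \<open>
  At the first zero \<open>t\<close> of the momentum the energy is \<open>G (v t) \<ge> 0\<close>, which leaves two possibilities. If
  \<open>v t \<ge> \<xi>\<^sub>0\<close>, the profile has remained in the region where \<open>g > 0\<close>, and the momentum is still negative at
  \<open>t\<close>. If \<open>v t = 0\<close>, the profile has reached the equilibrium \<open>0\<close> at rest, against backward uniqueness.
\<close>

lemma momentum_neg:
  assumes \<xi>: "\<xi>\<^sub>0 \<le> \<xi>" "\<xi> < M" and "0 < r" "0 \<le> energy \<xi> r"
    and nonneg: "\<And>s. 0 \<le> s \<Longrightarrow> s \<le> r \<Longrightarrow> 0 \<le> profile \<xi> s"
  shows "momentum \<xi> r < 0"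
proof (rule ccontr)
  assume "\<not> momentum \<xi> r < 0"
  obtain \<delta> where \<delta>: "\<delta> > 0" "\<And>s. 0 < s \<Longrightarrow> s \<le> \<delta> \<Longrightarrow> momentum \<xi> s < 0"
    using momentum_neg_near_0 g_pos \<xi> by blast
  with \<open>\<not> momentum \<xi> r < 0\<close> \<open>0 < r\<close> have "\<delta> < r" by force
  obtain t where t: "\<delta> < t" "t \<le> r" "momentum \<xi> t = 0"
    and before: "\<And>s. \<delta> \<le> s \<Longrightarrow> s < t \<Longrightarrow> momentum \<xi> s < 0"
  proof (rule first_crossing[of \<delta> r "momentum \<xi>" 0])
    show "continuous_on {\<delta>..r} (momentum \<xi>)"
      using \<delta> by (intro continuous_intros) auto
  qed (use \<delta> \<open>\<delta> < r\<close> \<open>\<not> momentum \<xi> r < 0\<close> in auto)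
  have neg: "momentum \<xi> s < 0" if "0 < s" "s < t" for s
    using \<delta>(2)[of s] before[of s] that by force
  have "0 \<le> energy \<xi> t"
    using energy_antimono[of t r \<xi>] assms t \<delta> by auto
  then have G: "0 \<le> G (profile \<xi> t)"
    using t by (simp add: energy_def)
  show False
  proof (cases "profile \<xi> t < \<xi>\<^sub>0")
    case True
    then have "profile \<xi> t = 0"
      using G G_neg[of "profile \<xi> t"] nonneg[of t] t \<delta> by force
    then show False
      using equilibrium_backward_unique[of \<delta> t \<xi>] t \<delta>(1) \<delta>(2)[of \<delta>] by auto
  next
    case False
    have "momentum \<xi> t < 0"
    proof (rule momentum_stays_neg[of \<delta>])
      fix s assume s: "\<delta> < s" "s < t"
      have "profile \<xi> t < profile \<xi> s"
        by (rule profile_strict_decreasing) (use s \<delta> neg in auto)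
      moreover have "profile \<xi> s < profile \<xi> 0"
        by (rule profile_strict_decreasing) (use s \<delta> neg in auto)
      ultimately show "0 \<le> g (profile \<xi> s)"
        using False \<xi> g_pos[of "profile \<xi> s"] by force
    qed (use t \<delta> in auto)
    with t show False by simp
  qed
qed

text \<open>
  Profile and energy are monotone and bounded, so both converge; hence so does the kinetic energy, and
  with it the momentum, whose sign is known. Then \<open>v'\<close> and \<open>w'\<close> converge as well, and their limits are zero
  because \<open>v\<close> and \<open>w\<close> converge.
\<close>

lemma decreasing_profile_limit:
  assumes nonneg: "\<And>r. 0 \<le> r \<Longrightarrow> 0 \<le> profile \<xi> r"
    and neg: "\<And>r. 0 < r \<Longrightarrow> momentum \<xi> r < 0"
  obtains l where "0 \<le> l" "l < \<xi>" "g l = 0"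
    "(profile \<xi> \<longlongrightarrow> l) at_top" "(energy \<xi> \<longlongrightarrow> G l) at_top"
proof -
  have less: "profile \<xi> b < profile \<xi> a" if "0 \<le> a" "a < b" for a b
    by (rule profile_strict_decreasing) (use that neg in auto)
  have anti: "profile \<xi> b \<le> profile \<xi> a" if "0 \<le> a" "a \<le> b" for a b
    using less[of a b] that by (cases "a = b") auto
  obtain l where l: "(profile \<xi> \<longlongrightarrow> l) at_top" "\<And>r. 0 \<le> r \<Longrightarrow> l \<le> profile \<xi> r" "0 \<le> l"
    using antimono_bounded_tendsto_at_top[of "profile \<xi>" 0] anti nonneg by blast
  have "l < \<xi>" using l(2)[of 1] less[of 0 1] by simp
  have G_lim: "((\<lambda>r. G (profile \<xi> r)) \<longlongrightarrow> G l) at_top"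
    using continuous_on_tendsto_compose[OF continuous_on_G[OF continuous_on_id, of UNIV] l(1)] by simp
  have g_lim: "((\<lambda>r. g (profile \<xi> r)) \<longlongrightarrow> g l) at_top"
    using continuous_on_tendsto_compose[OF continuous_on_g[OF continuous_on_id, of UNIV] l(1)] by simp
  have "continuous_on {0..\<xi>} G" by (intro continuous_intros)
  moreover have "{0..\<xi>} \<noteq> {}" using nonneg[of 0] by simp
  ultimately have "\<exists>y\<in>{0..\<xi>}. \<forall>s\<in>{0..\<xi>}. G y \<le> G s"
    by (intro continuous_attains_inf compact_Icc)
  then obtain y where y: "\<And>s. s \<in> {0..\<xi>} \<Longrightarrow> G y \<le> G s"
    by blast
  have "G y \<le> energy \<xi> r" if "0 \<le> r" for r
  proof -
    have "profile \<xi> r \<in> {0..\<xi>}" using that nonneg anti[of 0 r] by simp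
    then show ?thesis using y G_le_energy[of \<xi> r] by force
  qed
  with energy_antimono obtain e where e: "(energy \<xi> \<longlongrightarrow> e) at_top"
    by (rule antimono_bounded_tendsto_at_top[of "energy \<xi>" "G y"])
  define p where "p = - sqrt ((e - G l + 1)\<^sup>2 - 1)"
  have "((\<lambda>r. - sqrt ((energy \<xi> r - G (profile \<xi> r) + 1)\<^sup>2 - 1)) \<longlongrightarrow> p) at_top"
    unfolding p_def by (intro tendsto_intros e G_lim)
  moreover have "\<forall>\<^sub>F r in at_top. - sqrt ((energy \<xi> r - G (profile \<xi> r) + 1)\<^sup>2 - 1) = momentum \<xi> r"
    using eventually_gt_at_top[of 0]
  proof eventually_elim
    case (elim r)
    have "0 \<le> 1 + (momentum \<xi> r)\<^sup>2" by simp
    then show ?case using neg[OF elim] by (simp add: energy_def)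
  qed
  ultimately have w: "(momentum \<xi> \<longlongrightarrow> p) at_top"
    by (rule tendsto_cong[THEN iffD1, rotated])
  have "((\<lambda>r. velocity (momentum \<xi> r)) \<longlongrightarrow> velocity p) at_top"
    using continuous_on_tendsto_compose[OF continuous_on_velocity[OF continuous_on_id, of UNIV] w] by simp
  then have "velocity p = 0"
    using derivative_tendsto_zero[OF l(1)] profile_has_real_derivative by blast
  then have "p = 0"
    using sqrt_one_plus_square_pos[of p] by (simp add: velocity_def)
  have "((\<lambda>r. - g (profile \<xi> r) - real m / r * momentum \<xi> r) \<longlongrightarrow> - g l - 0 * p) at_top"
    by (intro tendsto_intros g_lim w tendsto_divide_0[OF tendsto_const]
        filterlim_at_top_imp_at_infinity filterlim_ident)
  then have "- g l - 0 * p = 0"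
    by (rule derivative_tendsto_zero[OF w]) (rule momentum_has_real_derivative)
  then have "g l = 0" by simp
  moreover have "((\<lambda>r. sqrt (1 + (momentum \<xi> r)\<^sup>2) - 1 + G (profile \<xi> r)) \<longlongrightarrow>
      sqrt (1 + p\<^sup>2) - 1 + G l) at_top"
    by (intro tendsto_intros w G_lim)
  then have "(energy \<xi> \<longlongrightarrow> G l) at_top"
    using \<open>p = 0\<close> by (simp add: energy_def[abs_def])
  ultimately show thesis using that l \<open>l < \<xi>\<close> by blast
qed

text \<open>
  Where \<open>v \<le> 0\<close> the potential \<open>G v\<close> vanishes and the energy is nonnegative.
\<close>

lemma profile_pos_of_negative_energy:
  assumes "0 \<le> r" "energy \<xi> r < 0" "r \<le> s"
  shows "0 < profile \<xi> s"
proof (rule ccontr)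
  assume "\<not> 0 < profile \<xi> s"
  then have "0 \<le> energy \<xi> s" using G_le_energy[of \<xi> s] G_nonpos[of "profile \<xi> s"] by simp
  with energy_antimono[of r s \<xi>] assms show False by simp
qed

text \<open>
  Between its last zero and \<open>s\<close> the profile descends somewhere, with negative momentum. As long as it is
  negative, \<open>g\<close> vanishes along it, the momentum keeps its sign, and the profile can only go further down.
\<close>

lemma profile_stays_negative:
  assumes "\<xi> > 0" "0 \<le> s" "profile \<xi> s < 0" "s \<le> t"
  shows "profile \<xi> t < 0"
proof (rule ccontr)
  assume t: "\<not> profile \<xi> t < 0"
  obtain x where x: "0 < x" "x \<le> s" "profile \<xi> (s - x) = 0"
      "\<And>y. 0 \<le> y \<Longrightarrow> y < x \<Longrightarrow> profile \<xi> (s - y) < 0"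
    by (rule first_crossing[of 0 s "\<lambda>y. profile \<xi> (s - y)" 0])
      (use assms in \<open>auto intro!: continuous_intros\<close>)
  have "\<exists>c. s - x < c \<and> c < s \<and> profile \<xi> s - profile \<xi> (s - x) = (s - (s - x)) * velocity (momentum \<xi> c)"
  proof -
    have "\<exists>l c. s - x < c \<and> c < s \<and> DERIV (profile \<xi>) c :> l \<and>
        profile \<xi> s - profile \<xi> (s - x) = (s - (s - x)) * l"
    proof (rule MVT)
      fix y assume "s - x < y" "y < s"
      then show "profile \<xi> differentiable (at y)"
        using x profile_has_real_derivative[of y \<xi>] by (auto simp: real_differentiable_def)
    qed (use x in simp, (rule continuous_intros continuous_on_id)+)
    then obtain l c where c: "s - x < c" "c < s" "DERIV (profile \<xi>) c :> l"
        "profile \<xi> s - profile \<xi> (s - x) = (s - (s - x)) * l" by blast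
    have "l = velocity (momentum \<xi> c)"
      by (rule DERIV_unique[OF c(3) profile_has_real_derivative]) (use c x in auto)
    with c show ?thesis by blast
  qed
  then obtain c where c: "s - x < c" "c < s" "profile \<xi> s = x * velocity (momentum \<xi> c)"
    using x by auto
  have "momentum \<xi> c < 0"
    using c x assms by (simp add: mult_less_0_iff velocity_neg_iff)
  have "profile \<xi> c < 0" using x(4)[of "s - c"] c by simp
  obtain t' where t': "c < t'" "t' \<le> t" "profile \<xi> t' = 0"
      "\<And>y. c \<le> y \<Longrightarrow> y < t' \<Longrightarrow> profile \<xi> y < 0"
    by (rule first_crossing[of c t "profile \<xi>" 0])
      (use assms c t \<open>profile \<xi> c < 0\<close> in \<open>auto intro!: continuous_intros\<close>)
  have "profile \<xi> t' < profile \<xi> c"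
  proof (rule profile_strict_decreasing)
    fix y assume y: "c < y" "y < t'"
    show "momentum \<xi> y < 0"
    proof (rule momentum_stays_neg[of c])
      fix z assume "c < z" "z < y"
      then show "0 \<le> g (profile \<xi> z)" using t'(4)[of z] y g_nonpos by auto
    qed (use c x y \<open>momentum \<xi> c < 0\<close> in auto)
  qed (use c x t' in auto)
  then show False using t' \<open>profile \<xi> c < 0\<close> by simp
qed

text \<open>
  If the profile never became negative, its energy would stay above the constant \<open>\<epsilon>\<close> of the proof: above
  the level \<open>\<xi>\<^sub>1\<close> because \<open>E \<ge> G v \<ge> G \<xi>\<^sub>1\<close>, and below it, that is, beyond radius \<open>R\<close>, because
  \<open>(E + C) * exp (- (m / R) * v)\<close> is nondecreasing. The role of \<open>C\<close> is that \<open>\<bar>w\<bar> \<le> E + C\<close> there, so that the energy loss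
  \<open>(m / r) * \<bar>v'\<bar> * \<bar>w\<bar>\<close> is bounded by \<open>(m / R) * \<bar>v'\<bar> * (E + C)\<close>.
  A positive energy forces the profile to decrease to a limit \<open>l\<close> with \<open>g l = 0\<close> and \<open>G l > 0\<close>, and there
  is no such \<open>l\<close>.
\<close>

lemma profile_reaches_zero:
  assumes \<xi>: "\<xi>\<^sub>0 < \<xi>\<^sub>1" "\<xi>\<^sub>1 < \<xi>" "\<xi> < M" and "R > 0"
    and high: "\<And>r. 0 \<le> r \<Longrightarrow> r \<le> R \<Longrightarrow> \<xi>\<^sub>1 < profile \<xi> r"
    and C: "\<And>s. 0 \<le> s \<Longrightarrow> s \<le> \<xi>\<^sub>1 \<Longrightarrow> 1 - G s \<le> C"
    and R: "C < (G \<xi>\<^sub>1 + C) * exp (- (real m * \<xi>\<^sub>1 / R))"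
  shows "\<exists>r\<ge>0. profile \<xi> r < 0"
proof (rule ccontr)
  assume "\<not> ?thesis"
  then have nonneg: "\<And>r. 0 \<le> r \<Longrightarrow> 0 \<le> profile \<xi> r" by force
  define \<epsilon> where "\<epsilon> = (G \<xi>\<^sub>1 + C) * exp (- (real m * \<xi>\<^sub>1 / R)) - C"
  have "\<epsilon> > 0" using R by (simp add: \<epsilon>_def)
  have "G \<xi>\<^sub>1 > 0" using G_less[of \<xi>\<^sub>0 \<xi>\<^sub>1] \<xi> G_\<xi>\<^sub>0 by simp
  have "C \<ge> 1" using C[of 0] G_nonpos[of 0] \<xi> \<xi>\<^sub>0_pos by simp
  have "(G \<xi>\<^sub>1 + C) * exp (- (real m * \<xi>\<^sub>1 / R)) \<le> (G \<xi>\<^sub>1 + C) * 1"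
    using \<open>G \<xi>\<^sub>1 > 0\<close> \<open>C \<ge> 1\<close> \<open>R > 0\<close> \<xi> \<xi>\<^sub>0_pos by (intro mult_left_mono) auto
  then have "\<epsilon> \<le> G \<xi>\<^sub>1" by (simp add: \<epsilon>_def)
  have energy_ge: "\<epsilon> \<le> energy \<xi> r" if r: "0 < r" and neg: "\<And>s. 0 < s \<Longrightarrow> s \<le> r \<Longrightarrow> momentum \<xi> s < 0" for r
  proof -
    have less: "profile \<xi> b < profile \<xi> a" if "0 \<le> a" "a < b" "b \<le> r" for a b
      by (rule profile_strict_decreasing) (use that neg in auto)
    show ?thesis
    proof (cases "\<xi>\<^sub>1 \<le> profile \<xi> r")
      case True
      have "profile \<xi> r < M" using less[of 0 r] r \<xi> by simp
      then have "G \<xi>\<^sub>1 \<le> G (profile \<xi> r)"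
        using True G_less[of \<xi>\<^sub>1 "profile \<xi> r"] \<xi> by (cases "\<xi>\<^sub>1 = profile \<xi> r") auto
      then show ?thesis using \<open>\<epsilon> \<le> G \<xi>\<^sub>1\<close> G_le_energy[of \<xi> r] by simp
    next
      case False
      then have "R < r" using high[of r] r by force
      have "continuous_on {R..r} (profile \<xi>)" by (rule continuous_intros continuous_on_id)+
      then obtain t where t: "R \<le> t" "t \<le> r" "profile \<xi> t = \<xi>\<^sub>1"
        using IVT2'[of "profile \<xi>" r \<xi>\<^sub>1 R] False high[of R] \<open>R > 0\<close> \<open>R < r\<close> by auto
      define k where "k = real m / R"
      let ?Y = "\<lambda>x. (energy \<xi> x + C) * exp (- (k * profile \<xi> x))"
      have "?Y t \<le> ?Y r"
      proof (rule DERIV_nonneg_imp_nondecreasing[OF \<open>t \<le> r\<close>])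
        fix x assume x: "t \<le> x" "x \<le> r"
        define w v where "w = momentum \<xi> x" and "v = velocity w"
        have "x > 0" using x t \<open>R > 0\<close> by simp
        have "w < 0" unfolding w_def using neg x \<open>x > 0\<close> by simp
        then have "v < 0" by (simp add: v_def velocity_neg_iff)
        let ?D = "- (real m / x * (v * w)) - (energy \<xi> x + C) * (k * v)"
        have "(?Y has_real_derivative ?D * exp (- (k * profile \<xi> x))) (at x)"
          using \<open>x > 0\<close> unfolding v_def w_def
          by (auto intro!: derivative_eq_intros energy_has_real_derivative profile_has_real_derivative
              simp: algebra_simps)
        moreover have "?D \<ge> 0"
        proof -
          have "profile \<xi> x \<le> \<xi>\<^sub>1"
            using less[of t x] x t \<open>R > 0\<close> by (cases "t = x") auto
          then have "1 - G (profile \<xi> x) \<le> C"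
            using C nonneg[of x] \<open>x > 0\<close> by simp
          moreover have "sqrt (w\<^sup>2) \<le> sqrt (1 + w\<^sup>2)" by (rule real_sqrt_le_mono) simp
          ultimately have "\<bar>w\<bar> \<le> energy \<xi> x + C"
            by (simp add: energy_def w_def)
          moreover have "real m / x \<le> k"
            unfolding k_def using x t \<open>R > 0\<close> by (intro divide_left_mono) auto
          ultimately have "real m / x * \<bar>w\<bar> \<le> k * (energy \<xi> x + C)"
            using \<open>R > 0\<close> by (intro mult_mono) (auto simp: k_def)
          then have "real m / x * \<bar>w\<bar> * \<bar>v\<bar> \<le> k * (energy \<xi> x + C) * \<bar>v\<bar>"
            by (intro mult_right_mono) auto
          then show ?thesis using \<open>w < 0\<close> \<open>v < 0\<close> by (simp add: algebra_simps)
        qed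
        ultimately show "\<exists>y. (?Y has_real_derivative y) (at x) \<and> 0 \<le> y"
          by (intro exI[of _ "?D * exp (- (k * profile \<xi> x))"]) auto
      qed
      moreover have "\<epsilon> + C \<le> ?Y t"
        using t G_le_energy[of \<xi> t] by (simp add: \<epsilon>_def k_def)
      moreover have "?Y r \<le> (energy \<xi> r + C) * 1"
      proof (rule mult_left_mono)
        show "exp (- (k * profile \<xi> r)) \<le> 1" using nonneg[of r] r \<open>R > 0\<close> by (simp add: k_def)
        show "0 \<le> energy \<xi> r + C"
          using G_le_energy[of \<xi> r] C[of "profile \<xi> r"] nonneg[of r] r False by simp
      qed
      ultimately show ?thesis by simp
    qed
  qed
  have energy_ge': "\<epsilon> \<le> energy \<xi> r" if "0 \<le> r" for r
  proof (rule ccontr)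
    assume *: "\<not> \<epsilon> \<le> energy \<xi> r"
    \<comment> \<open>A value strictly between \<open>0\<close> and \<open>\<epsilon>\<close> that the energy attains, with nonnegative energy until then.\<close>
    define e where "e = (max 0 (energy \<xi> r) + \<epsilon>) / 2"
    have e: "energy \<xi> r \<le> e" "e < \<epsilon>" "0 < e" using * \<open>\<epsilon> > 0\<close> by (auto simp: e_def)
    have "\<epsilon> \<le> energy \<xi> 0"
      using \<open>\<epsilon> \<le> G \<xi>\<^sub>1\<close> G_less[of \<xi>\<^sub>1 \<xi>] \<xi> by (simp add: energy_0)
    then obtain t where t: "0 \<le> t" "t \<le> r" "energy \<xi> t = e"
      using IVT2'[of "energy \<xi>" r e 0] e \<open>0 \<le> r\<close> continuous_on_energy_Icc[of 0] by auto
    have "t > 0" using t e \<open>\<epsilon> \<le> energy \<xi> 0\<close> by (cases "t = 0") auto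
    have "\<epsilon> \<le> energy \<xi> t"
    proof (rule energy_ge[OF \<open>t > 0\<close>])
      fix s assume "0 < s" "s \<le> t"
      then show "momentum \<xi> s < 0"
        using momentum_neg[of \<xi> s] energy_antimono[of s t \<xi>] t e \<xi> nonneg by auto
    qed
    with t e show False by simp
  qed
  have "momentum \<xi> r < 0" if "0 < r" for r
    using momentum_neg[of \<xi> r] energy_ge'[of r] that \<open>\<epsilon> > 0\<close> \<xi> nonneg by auto
  with nonneg obtain l where l: "0 \<le> l" "l < \<xi>" "g l = 0"
    "(profile \<xi> \<longlongrightarrow> l) at_top" "(energy \<xi> \<longlongrightarrow> G l) at_top"
    by (rule decreasing_profile_limit)
  have "\<epsilon> \<le> G l"
    by (rule tendsto_lowerbound[OF l(5)])
      (use eventually_ge_at_top[of 0] in eventually_elim, use energy_ge' in auto)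
  then show False
    using \<open>\<epsilon> > 0\<close> l G_neg[of l] G_nonpos[of l] g_pos[of l] \<xi> by force
qed

text \<open>
  The open sets \<open>Cross\<close> and \<open>Turn\<close> contain one end point each and are disjoint, so they do not cover the interval
  between \<open>\<xi>\<^sub>0\<close> and \<open>\<xi>\<^sub>2\<close>.
\<close>

lemma shooting:
  assumes \<xi>\<^sub>2: "\<xi>\<^sub>0 \<le> \<xi>\<^sub>2" "\<xi>\<^sub>2 < M" and reach: "\<exists>r\<ge>0. profile \<xi>\<^sub>2 r < 0"
  obtains \<xi> where "\<xi>\<^sub>0 \<le> \<xi>" "\<xi> < M"
    "\<And>r. 0 \<le> r \<Longrightarrow> 0 < profile \<xi> r" "\<And>r. 0 < r \<Longrightarrow> momentum \<xi> r < 0"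
    "(profile \<xi> \<longlongrightarrow> 0) at_top"
proof -
  define Cross where "Cross = (\<Union>r\<in>{0..}. {\<xi>. profile \<xi> r < 0})"
  define Turn where "Turn = (\<Union>r\<in>{0..}. {\<xi>. energy \<xi> r < 0})"
  have "open Cross"
    unfolding Cross_def
    by (intro open_UN ballI open_Collect_less continuous_on_profile_initial continuous_on_const)
  moreover have "open Turn"
    unfolding Turn_def energy_def
    by (intro open_UN ballI open_Collect_less continuous_intros continuous_on_profile_initial
        continuous_on_momentum_initial) auto
  moreover have "Cross \<inter> Turn \<inter> {\<xi>\<^sub>0..\<xi>\<^sub>2} = {}"
  proof (intro equals0I)
    fix \<xi> assume "\<xi> \<in> Cross \<inter> Turn \<inter> {\<xi>\<^sub>0..\<xi>\<^sub>2}"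
    then obtain s r where "\<xi> > 0" "0 \<le> s" "profile \<xi> s < 0" "0 \<le> r" "energy \<xi> r < 0"
      using \<xi>\<^sub>0_pos by (auto simp: Cross_def Turn_def)
    then show False
      using profile_stays_negative[of \<xi> s "max r s"] profile_pos_of_negative_energy[of r \<xi> "max r s"]
      by auto
  qed
  moreover have "\<xi>\<^sub>2 \<in> Cross" using reach by (auto simp: Cross_def)
  moreover have "\<xi>\<^sub>0 \<in> Turn"
  proof -
    obtain \<delta> where \<delta>: "\<delta> > 0" "\<And>s. 0 < s \<Longrightarrow> s \<le> \<delta> \<Longrightarrow> momentum \<xi>\<^sub>0 s < 0"
      using momentum_neg_near_0[of \<xi>\<^sub>0] g_pos[of \<xi>\<^sub>0] \<xi>\<^sub>2 by auto
    have "energy \<xi>\<^sub>0 \<delta> < energy \<xi>\<^sub>0 0"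
    proof (rule DERIV_neg_imp_decreasing_open[OF \<open>\<delta> > 0\<close>])
      fix x assume x: "0 < x" "x < \<delta>"
      have "momentum \<xi>\<^sub>0 x < 0" using \<delta> x by simp
      then have "velocity (momentum \<xi>\<^sub>0 x) * momentum \<xi>\<^sub>0 x > 0"
        by (simp add: velocity_neg_iff mult_neg_neg)
      then have "- (real m / x * (velocity (momentum \<xi>\<^sub>0 x) * momentum \<xi>\<^sub>0 x)) < 0"
        using m_pos x by simp
      then show "\<exists>y. (energy \<xi>\<^sub>0 has_real_derivative y) (at x) \<and> y < 0"
        using energy_has_real_derivative[OF x(1)] by blast
    qed (rule continuous_on_energy_Icc, simp)
    then have "energy \<xi>\<^sub>0 \<delta> < 0" by (simp add: energy_0 G_\<xi>\<^sub>0)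
    with \<delta> show ?thesis by (auto simp: Turn_def)
  qed
  ultimately have "\<not> {\<xi>\<^sub>0..\<xi>\<^sub>2} \<subseteq> Cross \<union> Turn"
    using connectedD[OF connected_Icc, of Cross Turn \<xi>\<^sub>0 \<xi>\<^sub>2] \<xi>\<^sub>2
    by (metis IntI atLeastAtMost_iff empty_iff order_refl)
  then obtain \<xi> where \<xi>: "\<xi>\<^sub>0 \<le> \<xi>" "\<xi> < M" "\<xi> \<notin> Cross" "\<xi> \<notin> Turn"
    using \<xi>\<^sub>2 by force
  have nonneg: "0 \<le> profile \<xi> r" "0 \<le> energy \<xi> r" if "0 \<le> r" for r
    using \<xi> that by (auto simp: Cross_def Turn_def not_less)
  have neg: "momentum \<xi> r < 0" if "0 < r" for r
    using momentum_neg[of \<xi> r] \<xi> nonneg that by auto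
  have pos: "0 < profile \<xi> r" if "0 \<le> r" for r
    using profile_strict_decreasing[of r "r + 1" \<xi>] nonneg(1)[of "r + 1"] neg that by force
  from nonneg(1) neg obtain l where l: "0 \<le> l" "l < \<xi>" "g l = 0"
      "(profile \<xi> \<longlongrightarrow> l) at_top" "(energy \<xi> \<longlongrightarrow> G l) at_top"
    by (rule decreasing_profile_limit)
  have "0 \<le> G l"
    by (rule tendsto_lowerbound[OF l(5)])
      (use eventually_ge_at_top[of 0] in eventually_elim, use nonneg in auto)
  then have "l = 0"
    using l G_neg[of l] g_pos[of l] \<xi> by force
  with l \<xi> pos neg show thesis using that by blast
qed

end

section \<open>Radial vector fields\<close>

lemma norm_tendsto_at_right_0: "filterlim norm (at_right 0) (at (0::'a::real_normed_vector))"
  unfolding filterlim_at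
  by (auto simp: eventually_at_filter intro!: tendsto_eq_intros)

lemma radial_field_has_derivative:
  fixes x :: "'a::real_inner"
  assumes "x \<noteq> 0" and \<omega>: "(\<omega> has_real_derivative d) (at (norm x))"
  shows "((\<lambda>y. \<omega> (norm y) *\<^sub>R y) has_derivative
    (\<lambda>h. \<omega> (norm x) *\<^sub>R h + (d * (x \<bullet> h) / norm x) *\<^sub>R x)) (at x)"
proof -
  have "((\<lambda>y. \<omega> (norm y)) has_derivative (\<lambda>h. d * (h \<bullet> sgn x))) (at x)"
    using has_derivative_compose[OF has_derivative_norm[OF \<open>x \<noteq> 0\<close>]] \<omega>
    unfolding has_field_derivative_def by blast
  then have "((\<lambda>y. \<omega> (norm y) *\<^sub>R y) has_derivative
      (\<lambda>h. \<omega> (norm x) *\<^sub>R h + (d * (h \<bullet> sgn x)) *\<^sub>R x)) (at x)"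
    by (rule has_derivative_scaleR) (rule has_derivative_ident)
  then show ?thesis
    by (simp add: sgn_div_norm inner_commute divide_inverse mult_ac)
qed

text \<open>
  The value \<open>\<omega> 0\<close> is immaterial because it multiplies the zero vector.
\<close>

lemma radial_field_has_derivative_0:
  assumes \<omega>: "(\<omega> \<longlongrightarrow> c) (at_right 0)"
  shows "((\<lambda>y. \<omega> (norm y) *\<^sub>R y) has_derivative (\<lambda>h. c *\<^sub>R h)) (at (0::'a::real_inner))"
proof -
  have "((\<lambda>h::'a. \<bar>\<omega> (norm h) - c\<bar>) \<longlongrightarrow> \<bar>c - c\<bar>) (at 0)"
    by (intro tendsto_intros filterlim_compose[OF \<omega> norm_tendsto_at_right_0])
  then have "((\<lambda>h::'a. norm (\<omega> (norm (0 + h)) *\<^sub>R (0 + h) - \<omega> (norm (0::'a)) *\<^sub>R 0 - c *\<^sub>R h) / norm h)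
      \<longlongrightarrow> 0) (at 0)"
    unfolding diff_self abs_zero
    by (rule tendsto_cong[THEN iffD1, rotated])
      (auto simp: eventually_at_filter simp flip: scaleR_diff_left)
  then show ?thesis
    by (auto simp: has_derivative_at intro: bounded_linear_scaleR_right)
qed

text \<open>
  The term of the derivative that contains \<open>\<omega>'\<close> is of size \<open>\<bar>r * \<omega>' r\<bar>\<close> at distance \<open>r\<close> from the origin. Its formula
  gives \<open>0\<close> at \<open>x = 0\<close>, whatever \<open>\<omega>' 0\<close> is, so one expression describes the derivative everywhere.
\<close>

lemma radial_field_continuously_differentiable:
  fixes \<omega> \<omega>' :: "real \<Rightarrow> real"
  assumes cont: "continuous_on {0..} \<omega>"
    and deriv: "\<And>r. r > 0 \<Longrightarrow> (\<omega> has_real_derivative \<omega>' r) (at r)"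
    and cont': "continuous_on {0<..} \<omega>'"
    and lim: "((\<lambda>r. r * \<omega>' r) \<longlongrightarrow> 0) (at_right 0)"
  defines "D \<equiv> \<lambda>x h::'a::real_inner. \<omega> (norm x) *\<^sub>R h + (\<omega>' (norm x) * (x \<bullet> h) / norm x) *\<^sub>R x"
  shows "((\<lambda>y. \<omega> (norm y) *\<^sub>R y) has_derivative D x) (at x)"
    and "continuous_on UNIV (\<lambda>x. D x h)"
proof -
  have \<omega>0: "(\<omega> \<longlongrightarrow> \<omega> 0) (at_right 0)"
    using cont by (auto simp: continuous_on_def intro: tendsto_within_subset)
  show "((\<lambda>y. \<omega> (norm y) *\<^sub>R y) has_derivative D x) (at x)"
  proof (cases "x = 0")
    case True
    then show ?thesis
      using radial_field_has_derivative_0[OF \<omega>0] by (simp add: D_def)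
  next
    case False
    then show ?thesis
      unfolding D_def by (intro radial_field_has_derivative deriv) auto
  qed
  have "isCont (\<lambda>x. D x h) x" for x
  proof (cases "x = 0")
    case True
    have "((\<lambda>x. (\<omega>' (norm x) * (x \<bullet> h) / norm x) *\<^sub>R x) \<longlongrightarrow> 0) (at (0::'a))"
    proof (rule Lim_null_comparison)
      show "\<forall>\<^sub>F x in at 0. norm ((\<omega>' (norm x) * (x \<bullet> h) / norm x) *\<^sub>R x)
          \<le> \<bar>norm x * \<omega>' (norm x)\<bar> * norm h"
        unfolding eventually_at_filter
      proof (rule always_eventually, intro allI impI)
        fix x :: 'a assume "x \<noteq> 0"
        have "norm ((\<omega>' (norm x) * (x \<bullet> h) / norm x) *\<^sub>R x) = \<bar>\<omega>' (norm x)\<bar> * \<bar>x \<bullet> h\<bar>"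
          using \<open>x \<noteq> 0\<close> by (simp add: abs_mult)
        also have "\<dots> \<le> \<bar>\<omega>' (norm x)\<bar> * (norm x * norm h)"
          by (intro mult_left_mono Cauchy_Schwarz_ineq2) simp
        finally show "norm ((\<omega>' (norm x) * (x \<bullet> h) / norm x) *\<^sub>R x)
          \<le> \<bar>norm x * \<omega>' (norm x)\<bar> * norm h" by (simp add: abs_mult mult_ac)
      qed
      have "((\<lambda>x::'a. \<bar>norm x * \<omega>' (norm x)\<bar> * norm h) \<longlongrightarrow> \<bar>0\<bar> * norm h) (at 0)"
        by (intro tendsto_intros filterlim_compose[OF lim norm_tendsto_at_right_0])
      then show "((\<lambda>x::'a. \<bar>norm x * \<omega>' (norm x)\<bar> * norm h) \<longlongrightarrow> 0) (at 0)" by simp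
    qed
    moreover have "((\<lambda>x::'a. \<omega> (norm x) *\<^sub>R h) \<longlongrightarrow> \<omega> 0 *\<^sub>R h) (at 0)"
      by (intro tendsto_intros filterlim_compose[OF \<omega>0 norm_tendsto_at_right_0])
    ultimately have "((\<lambda>x. D x h) \<longlongrightarrow> \<omega> 0 *\<^sub>R h + 0) (at 0)"
      unfolding D_def by (intro tendsto_add)
    then show ?thesis by (simp add: True isCont_def D_def)
  next
    case False
    have "isCont \<omega>' (norm x)"
      using cont' False by (auto simp: continuous_on_eq_continuous_at)
    moreover have "isCont \<omega> (norm x)"
      using deriv[of "norm x"] False by (auto intro: DERIV_isCont)
    ultimately have "isCont (\<lambda>x. \<omega>' (norm x)) x" "isCont (\<lambda>x. \<omega> (norm x)) x"
      by (auto intro: isCont_o2[OF continuous_norm[OF continuous_ident]])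
    then show ?thesis
      unfolding D_def using False by (intro continuous_intros) auto
  qed
  then show "continuous_on UNIV (\<lambda>x. D x h)"
    by (simp add: continuous_at_imp_continuous_on)
qed

lemma gradient_eq: "GDERIV u x :> D \<Longrightarrow> gradient u x = D"
proof -
  assume D: "GDERIV u x :> D"
  have "D' = D" if "GDERIV u x :> D'" for D'
  proof -
    have "(\<lambda>h. h \<bullet> D') = (\<lambda>h. h \<bullet> D)"
      using that D unfolding gderiv_def by (rule has_derivative_unique)
    then show ?thesis by (metis vector_eq_ldot)
  qed
  with D show ?thesis unfolding gradient_def by (rule the_equality)
qed

section \<open>From radial profiles to classical solutions\<close>

context radial_ivp
begin

text \<open>
  The value at \<open>0\<close> is the limit of \<open>momentum / r\<close>.
\<close>

definition momentum_quotient :: "real \<Rightarrow> real \<Rightarrow> real"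
  where "momentum_quotient \<xi> r = (if r = 0 then - g \<xi> / real (Suc m) else momentum \<xi> r / r)"

text \<open>
  The derivative of \<^const>\<open>momentum_quotient\<close>, written so that \<open>r\<close> times it visibly tends to \<open>0\<close> with \<open>r\<close>.
\<close>

definition momentum_quotient' :: "real \<Rightarrow> real \<Rightarrow> real"
  where "momentum_quotient' \<xi> r =
    - (g (profile \<xi> r) + real (Suc m) * momentum_quotient \<xi> r) / r"

lemma momentum_eq: "momentum \<xi> r = r * momentum_quotient \<xi> r"
  by (simp add: momentum_quotient_def)

lemma momentum_quotient_has_real_derivative:
  assumes "r > 0"
  shows "(momentum_quotient \<xi> has_real_derivative momentum_quotient' \<xi> r) (at r)"
proof -
  have "((\<lambda>s. momentum \<xi> s / s) has_real_derivative momentum_quotient' \<xi> r) (at r)"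
    using assms
    by (intro DERIV_cong[OF DERIV_divide[OF momentum_has_real_derivative DERIV_ident]])
      (auto simp: momentum_quotient'_def momentum_eq field_simps)
  then show ?thesis
    by (rule has_field_derivative_transform_within[where d=r])
      (use assms in \<open>auto simp: momentum_quotient_def dist_real_def\<close>)
qed

lemma momentum_quotient_tendsto_0:
  "(momentum_quotient \<xi> \<longlongrightarrow> - g \<xi> / real (Suc m)) (at 0 within {0..})"
proof (rule Lim_transform2[of "\<lambda>_. - g \<xi> / real (Suc m)"])
  show "((\<lambda>r. - g \<xi> / real (Suc m) - momentum_quotient \<xi> r) \<longlongrightarrow> 0) (at 0 within {0..})"
  proof (rule Lim_null_comparison)
    show "((\<lambda>r. L * r) \<longlongrightarrow> 0) (at 0 within {0..})"
      by (auto intro!: tendsto_eq_intros)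
    show "\<forall>\<^sub>F r in at 0 within {0..}. norm (- g \<xi> / real (Suc m) - momentum_quotient \<xi> r) \<le> L * r"
      unfolding eventually_at_filter
    proof (rule always_eventually, intro allI impI)
      fix r :: real assume "r \<noteq> 0" "r \<in> {0..}"
      then have r: "r > 0" by simp
      have "r * \<bar>momentum_quotient \<xi> r + g \<xi> / real (Suc m)\<bar>
          = \<bar>momentum \<xi> r + g \<xi> / real (Suc m) * r\<bar>"
        using r by (simp only: momentum_eq mult.commute[of _ r] abs_mult abs_of_pos
            flip: distrib_left)
      also have "\<dots> \<le> r * (L * r)"
        using abs_momentum_plus_le[of r \<xi>] r by (simp add: mult_ac)
      finally have "\<bar>momentum_quotient \<xi> r + g \<xi> / real (Suc m)\<bar> \<le> L * r"
        using r by simp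
      then show "norm (- g \<xi> / real (Suc m) - momentum_quotient \<xi> r) \<le> L * r"
        unfolding real_norm_def minus_divide_left[symmetric] by linarith
    qed
  qed
qed simp

lemma continuous_on_momentum_quotient: "continuous_on {0..} (momentum_quotient \<xi>)"
proof -
  have "continuous (at r within {0..}) (momentum_quotient \<xi>)" if "r \<ge> 0" for r
  proof (cases "r = 0")
    case True
    then show ?thesis
      using momentum_quotient_tendsto_0[of \<xi>] by (simp add: continuous_within momentum_quotient_def)
  next
    case False
    then show ?thesis
      using that momentum_quotient_has_real_derivative[of r \<xi>]
      by (auto intro: continuous_at_imp_continuous_at_within DERIV_isCont)
  qed
  then show ?thesis by (simp add: continuous_on_eq_continuous_within)
qed

lemma continuous_on_momentum_quotient': "continuous_on {0<..} (momentum_quotient' \<xi>)"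
  unfolding momentum_quotient'_def
  by (intro continuous_intros continuous_on_subset[OF continuous_on_momentum_quotient]) auto

lemma momentum_quotient'_tendsto_0: "((\<lambda>r. r * momentum_quotient' \<xi> r) \<longlongrightarrow> 0) (at_right 0)"
proof -
  have "isCont (\<lambda>r. g (profile \<xi> r)) 0"
    using continuous_on_g[OF continuous_on_profile_UNIV[of \<xi>]]
    by (simp add: continuous_on_eq_continuous_at)
  then have "((\<lambda>r. g (profile \<xi> r)) \<longlongrightarrow> g \<xi>) (at_right 0)"
    by (auto simp: isCont_def intro: tendsto_within_subset)
  moreover have "(momentum_quotient \<xi> \<longlongrightarrow> - g \<xi> / real (Suc m)) (at_right 0)"
    by (rule tendsto_within_subset[OF momentum_quotient_tendsto_0]) auto
  ultimately have "((\<lambda>r. - (g (profile \<xi> r) + real (Suc m) * momentum_quotient \<xi> r)) \<longlongrightarrow>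
      - (g \<xi> + real (Suc m) * (- g \<xi> / real (Suc m)))) (at_right 0)"
    by (intro tendsto_intros)
  then have "((\<lambda>r. - (g (profile \<xi> r) + real (Suc m) * momentum_quotient \<xi> r)) \<longlongrightarrow> 0) (at_right 0)"
    by (simp del: of_nat_Suc)
  then show ?thesis
    by (rule tendsto_cong[THEN iffD1, rotated])
      (auto simp: eventually_at_filter momentum_quotient'_def)
qed

text \<open>
  The quotient of the velocity of the profile by \<open>r\<close>, continuously extended to \<open>r = 0\<close>.
\<close>

definition velocity_quotient :: "real \<Rightarrow> real \<Rightarrow> real"
  where "velocity_quotient \<xi> r = momentum_quotient \<xi> r / sqrt (1 + (momentum \<xi> r)\<^sup>2)"

definition velocity_quotient' :: "real \<Rightarrow> real \<Rightarrow> real"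
  where "velocity_quotient' \<xi> r =
    (momentum_quotient' \<xi> r - r * momentum_quotient \<xi> r ^ 3) / sqrt (1 + (momentum \<xi> r)\<^sup>2) ^ 3"

lemma velocity_momentum: "velocity (momentum \<xi> r) = r * velocity_quotient \<xi> r"
  by (simp add: velocity_def velocity_quotient_def momentum_eq)

lemma one_plus_square_nonzero: "1 + (p::real)\<^sup>2 \<noteq> 0"
  by (metis add_pos_nonneg less_irrefl zero_less_one zero_le_power2)

lemma velocity_quotient_has_real_derivative:
  assumes "r > 0"
  shows "(velocity_quotient \<xi> has_real_derivative velocity_quotient' \<xi> r) (at r)"
proof -
  define q q' s where "q = momentum_quotient \<xi> r" and "q' = momentum_quotient' \<xi> r"
    and "s = sqrt (1 + (momentum \<xi> r)\<^sup>2)"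
  have s: "s > 0" "s * s = 1 + (r * q)\<^sup>2"
    using sqrt_one_plus_square_pos[of "momentum \<xi> r"]
    by (simp_all add: s_def q_def momentum_eq)
  have w: "momentum \<xi> r = r * q" by (simp add: q_def momentum_eq)
  have "((\<lambda>r. momentum_quotient \<xi> r / sqrt (1 + (momentum \<xi> r)\<^sup>2)) has_real_derivative
      (q' * s - q * (velocity (r * q) * (1 * q + q' * r))) / (s * s)) (at r)"
    unfolding s_def momentum_eq[abs_def] q_def q'_def
    using assms sqrt_one_plus_square_pos[of "momentum \<xi> r"]
    by (intro DERIV_divide momentum_quotient_has_real_derivative
        DERIV_chain2[OF sqrt_one_plus_square_has_real_derivative] DERIV_mult DERIV_ident)
      (auto simp: momentum_eq one_plus_square_nonzero)
  moreover have "(q' * s - q * (velocity (r * q) * (1 * q + q' * r))) / (s * s)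
      = velocity_quotient' \<xi> r"
  proof -
    have "velocity (r * q) = r * q / s" by (simp add: velocity_def s_def w)
    then have "(q' * s - q * (velocity (r * q) * (1 * q + q' * r))) / (s * s)
        = (q' * (s * s) - q * (r * q) * (q + q' * r)) / s ^ 3"
      using s(1) by (simp add: field_simps power3_eq_cube)
    also have "q' * (s * s) - q * (r * q) * (q + q' * r) = q' - r * q ^ 3"
      unfolding s(2) by (simp add: algebra_simps power2_eq_square power3_eq_cube)
    finally show ?thesis
      by (simp add: velocity_quotient'_def q_def q'_def s_def)
  qed
  ultimately show ?thesis by (simp add: velocity_quotient_def[abs_def])
qed

lemma continuous_on_velocity_quotient: "continuous_on {0..} (velocity_quotient \<xi>)"
  unfolding velocity_quotient_def
  using sqrt_one_plus_square_pos
  by (intro continuous_intros continuous_on_momentum_quotient) (auto simp: one_plus_square_nonzero)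

lemma continuous_on_velocity_quotient': "continuous_on {0<..} (velocity_quotient' \<xi>)"
  unfolding velocity_quotient'_def
  by (intro continuous_intros continuous_on_momentum_quotient'
      continuous_on_subset[OF continuous_on_momentum_quotient]) (auto simp: one_plus_square_nonzero)

lemma velocity_quotient'_tendsto_0: "((\<lambda>r. r * velocity_quotient' \<xi> r) \<longlongrightarrow> 0) (at_right 0)"
proof -
  have q: "(momentum_quotient \<xi> \<longlongrightarrow> - g \<xi> / real (Suc m)) (at_right 0)"
    by (rule tendsto_within_subset[OF momentum_quotient_tendsto_0]) auto
  have "((\<lambda>r. (r * momentum_quotient' \<xi> r - r * r * momentum_quotient \<xi> r ^ 3) /
      sqrt (1 + (r * momentum_quotient \<xi> r)\<^sup>2) ^ 3) \<longlongrightarrow>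
      (0 - 0 * 0 * (- g \<xi> / real (Suc m)) ^ 3) / sqrt (1 + (0 * (- g \<xi> / real (Suc m)))\<^sup>2) ^ 3) (at_right 0)"
    by (intro tendsto_intros momentum_quotient'_tendsto_0 q) simp
  then show ?thesis
    by (simp add: velocity_quotient'_def[abs_def] momentum_eq right_diff_distrib mult.assoc)
qed

lemma abs_profile_diff_initial_le_square:
  assumes "r \<ge> 0"
  shows "\<bar>profile \<xi> r - \<xi>\<bar> \<le> B * r * r"
proof -
  have "norm (integral {0..r} (\<lambda>s. velocity (flux (profile \<xi>) s))) \<le> (B * r) * (r - 0)"
  proof (rule integral_bound[OF assms continuous_on_velocity_flux[OF continuous_on_profile_UNIV]])
    fix s assume s: "s \<in> {0..r}"
    have "norm (velocity (flux (profile \<xi>) s)) \<le> \<bar>flux (profile \<xi>) s\<bar>"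
      using abs_velocity_le by simp
    also have "\<dots> \<le> B * s" using abs_flux_le[OF continuous_on_profile_UNIV] s by simp
    also have "\<dots> \<le> B * r" using s B_nonneg by (simp add: mult_left_mono)
    finally show "norm (velocity (flux (profile \<xi>) s)) \<le> B * r" .
  qed
  then show ?thesis
    using assms by (subst profile_eq) (simp add: integral_step_def)
qed

lemma GDERIV_radial_profile:
  "GDERIV (\<lambda>x. profile \<xi> (norm x)) (x::'a::real_inner) :> velocity_quotient \<xi> (norm x) *\<^sub>R x"
proof (cases "x = 0")
  case False
  have "GDERIV (\<lambda>x. profile \<xi> (norm x)) x :> velocity (momentum \<xi> (norm x)) *\<^sub>R sgn x"
    using False by (intro GDERIV_DERIV_compose GDERIV_norm profile_has_real_derivative) auto
  moreover have "velocity (momentum \<xi> (norm x)) *\<^sub>R sgn x = velocity_quotient \<xi> (norm x) *\<^sub>R x"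
    using False by (simp add: velocity_momentum sgn_div_norm)
  ultimately show ?thesis by simp
next
  case True
  have "((\<lambda>h::'a. norm (profile \<xi> (norm (0 + h)) - profile \<xi> (norm (0::'a)) - 0) / norm h) \<longlongrightarrow> 0) (at 0)"
  proof (rule Lim_null_comparison)
    show "((\<lambda>h::'a. B * norm h) \<longlongrightarrow> 0) (at 0)"
      by (auto intro!: tendsto_eq_intros)
    show "\<forall>\<^sub>F h::'a in at 0.
        norm (norm (profile \<xi> (norm (0 + h)) - profile \<xi> (norm (0::'a)) - 0) / norm h) \<le> B * norm h"
      using abs_profile_diff_initial_le_square[of _ \<xi>]
      by (auto simp: eventually_at_filter divide_le_eq)
  qed
  then show ?thesis
    unfolding gderiv_def by (simp add: True has_derivative_at)
qed

lemma gradient_radial_profile: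
  "gradient (\<lambda>x :: real ^ 'n. profile \<xi> (norm x)) = (\<lambda>x. velocity_quotient \<xi> (norm x) *\<^sub>R x)"
  by (rule ext, rule gradient_eq, rule GDERIV_radial_profile)

lemma velocity_field_has_derivative:
  "((\<lambda>y::'a::real_inner. velocity_quotient \<xi> (norm y) *\<^sub>R y) has_derivative
    (\<lambda>h. velocity_quotient \<xi> (norm x) *\<^sub>R h +
      (velocity_quotient' \<xi> (norm x) * (x \<bullet> h) / norm x) *\<^sub>R x)) (at x)"
  and continuous_on_velocity_field_derivative:
  "continuous_on UNIV (\<lambda>x::'a. velocity_quotient \<xi> (norm x) *\<^sub>R h +
      (velocity_quotient' \<xi> (norm x) * (x \<bullet> h) / norm x) *\<^sub>R x)"
  by (rule radial_field_continuously_differentiable[OF continuous_on_velocity_quotient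
      velocity_quotient_has_real_derivative continuous_on_velocity_quotient'
      velocity_quotient'_tendsto_0], assumption)+

lemma momentum_field_has_derivative:
  "((\<lambda>y::'a::real_inner. momentum_quotient \<xi> (norm y) *\<^sub>R y) has_derivative
    (\<lambda>h. momentum_quotient \<xi> (norm x) *\<^sub>R h +
      (momentum_quotient' \<xi> (norm x) * (x \<bullet> h) / norm x) *\<^sub>R x)) (at x)"
  by (rule radial_field_continuously_differentiable[OF continuous_on_momentum_quotient
      momentum_quotient_has_real_derivative continuous_on_momentum_quotient'
      momentum_quotient'_tendsto_0])

lemma C2_radial_profile: "C2 (\<lambda>x :: real ^ 'n. profile \<xi> (norm x))"
  unfolding C2_def gradient_radial_profile
proof (intro conjI allI)
    show "(\<lambda>x :: real ^ 'n. profile \<xi> (norm x)) differentiable_on UNIV"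
      using GDERIV_radial_profile by (auto simp: differentiable_on_def differentiable_def gderiv_def)
    show "(\<lambda>x :: real ^ 'n. velocity_quotient \<xi> (norm x) *\<^sub>R x) differentiable_on UNIV"
      using velocity_field_has_derivative by (auto simp: differentiable_on_def differentiable_def)
    show "continuous_on UNIV (\<lambda>x. frechet_derivative
        (\<lambda>x :: real ^ 'n. velocity_quotient \<xi> (norm x) *\<^sub>R x) (at x) (axis i 1))" for i
      unfolding frechet_derivative_at[OF velocity_field_has_derivative, symmetric]
      by (rule continuous_on_velocity_field_derivative)
qed

lemma norm_gradient_radial_profile:
  "norm (gradient (\<lambda>x :: real ^ 'n. profile \<xi> (norm x)) x) = \<bar>velocity (momentum \<xi> (norm x))\<bar>"
  by (simp add: gradient_radial_profile velocity_momentum abs_mult)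

lemma one_minus_velocity_square: "sqrt (1 - (velocity p)\<^sup>2) = 1 / sqrt (1 + p\<^sup>2)"
proof -
  have "1 - (velocity p)\<^sup>2 = 1 / (1 + p\<^sup>2)"
    using one_plus_square_nonzero[of p] by (simp add: velocity_def power_divide field_simps)
  then show ?thesis by (simp add: real_sqrt_divide)
qed

text \<open>
  By the choice of \<^const>\<open>velocity\<close>, dividing the gradient by the square root turns velocities back into momenta.
\<close>

lemma flux_field_radial_profile:
  fixes y :: "real ^ 'n" and \<xi> :: real
  defines "u \<equiv> \<lambda>x :: real ^ 'n. profile \<xi> (norm x)"
  shows "gradient u y /\<^sub>R sqrt (1 - (norm (gradient u y))\<^sup>2) = momentum_quotient \<xi> (norm y) *\<^sub>R y"
  unfolding u_def norm_gradient_radial_profile power2_abs one_minus_velocity_square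
  using sqrt_one_plus_square_pos[of "momentum \<xi> (norm y)"]
  by (simp add: gradient_radial_profile velocity_quotient_def one_plus_square_nonzero)

text \<open>
  The trace of the derivative of \<open>q (norm x) x\<close> is \<open>(m + 1) * q r + r * q' r\<close>, which is \<open>- g\<close> by the definition
  of \<open>q'\<close>; at the origin it is \<open>(m + 1) * q 0 = - g \<xi>\<close>.
\<close>

lemma divergence_radial_profile:
  fixes x :: "real ^ 'n" and \<xi> :: real
  assumes card: "CARD('n) = Suc m"
  defines "u \<equiv> \<lambda>x :: real ^ 'n. profile \<xi> (norm x)"
  shows "divergence (\<lambda>y. gradient u y /\<^sub>R sqrt (1 - (norm (gradient u y))\<^sup>2)) x = - g (u x)"
proof -
  let ?q = "momentum_quotient \<xi>" and ?q' = "momentum_quotient' \<xi>"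
  have "divergence (\<lambda>y. gradient u y /\<^sub>R sqrt (1 - (norm (gradient u y))\<^sup>2)) x =
      (\<Sum>i\<in>UNIV. ?q (norm x) + ?q' (norm x) / norm x * (x $ i * x $ i))"
    unfolding u_def flux_field_radial_profile divergence_def
      frechet_derivative_at[OF momentum_field_has_derivative, symmetric]
    by (simp add: inner_axis mult.assoc)
  also have "\<dots> = real (Suc m) * ?q (norm x) + ?q' (norm x) / norm x * (norm x)\<^sup>2"
    by (simp add: sum.distrib card power2_norm_eq_inner inner_vec_def sum_distrib_left
        sum_divide_distrib)
  also have "\<dots> = - g (u x)"
    by (cases "x = 0")
      (auto simp: u_def momentum_quotient'_def momentum_quotient_def power2_eq_square simp del: of_nat_Suc)
  finally show ?thesis .
qed

lemma classical_solution_radial_profile: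
  assumes "CARD('n) = Suc m"
    and pos: "\<And>r. 0 \<le> r \<Longrightarrow> 0 < profile \<xi> r"
    and lim: "(profile \<xi> \<longlongrightarrow> 0) at_top"
    and f: "\<And>r. 0 \<le> r \<Longrightarrow> f (profile \<xi> r) = g (profile \<xi> r)"
  shows "classical_solution f (\<lambda>x :: real ^ 'n. profile \<xi> (norm x))"
  unfolding classical_solution_def
proof (intro conjI allI)
  show "((\<lambda>x :: real ^ 'n. profile \<xi> (norm x)) \<longlongrightarrow> 0) at_infinity"
    by (rule filterlim_compose[OF lim filterlim_norm_at_top])
  fix x :: "real ^ 'n"
  show "divergence (\<lambda>y. gradient (\<lambda>x :: real ^ 'n. profile \<xi> (norm x)) y /\<^sub>R
      sqrt (1 - (norm (gradient (\<lambda>x. profile \<xi> (norm x)) y))\<^sup>2)) x + f (profile \<xi> (norm x)) = 0"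
    by (simp only: divergence_radial_profile[OF assms(1)] f norm_ge_zero)
qed (use pos abs_velocity_less_one in
    \<open>auto simp: C2_radial_profile norm_gradient_radial_profile\<close>)

lemma radially_decreasing_radial_profile:
  assumes "\<And>r. 0 < r \<Longrightarrow> momentum \<xi> r < 0"
  shows "radially_decreasing (\<lambda>x :: real ^ 'n. profile \<xi> (norm x))"
  unfolding radially_decreasing_def
proof (intro exI[of _ "profile \<xi>"] conjI allI refl)
  show "strict_antimono_on {0..} (profile \<xi>)"
    using profile_strict_decreasing[of _ _ \<xi>] assms by (auto simp: monotone_on_def)
qed

end

section \<open>The nonlinearity and its cutoffs\<close>

locale ground_state_nonlinearity =
  fixes f :: "real \<Rightarrow> real"
  assumes f_0: "f 0 = 0"
    and locally_lipschitz: "locally_lipschitz_on {0..} f"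
    and alpha_set: "{\<xi>. \<xi> > 0 \<and> f \<xi> \<ge> 0} \<noteq> {}"
    and alpha_pos: "alpha f > 0"
    and primitive_pos: "\<exists>\<gamma>>0. primitive f \<gamma> > 0"
    and f_pos: "alpha f < \<xi> \<Longrightarrow> \<xi> \<le> xi0 f \<Longrightarrow> f \<xi> > 0"
begin

lemma lipschitz_on_Icc:
  obtains L where "L-lipschitz_on {0..b} f"
proof -
  have "local_lipschitz {0::real} {0..b} (\<lambda>_. f)"
    using locally_lipschitz unfolding locally_lipschitz_on_def
    by (rule local_lipschitz_subset) auto
  then show thesis
    by (rule local_lipschitz_compact_implies_lipschitz) (use that in auto)
qed

lemma continuous_on_f:
  assumes "S \<subseteq> {0..}"
  shows "continuous_on S f"
  using local_lipschitz_continuous_on[OF locally_lipschitz[unfolded locally_lipschitz_on_def]] assms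
  by (auto intro: continuous_on_subset)

lemma primitive_eq_integral:
  assumes "0 \<le> s"
  shows "primitive f s = integral {0..s} f"
proof -
  have "set_integrable lborel {0..s} f"
    by (rule borel_integrable_atLeastAtMost') (rule continuous_on_f, auto)
  then show ?thesis
    using interval_integral_eq_integral[OF assms] by (simp add: primitive_def zero_ereal_def)
qed

lemma primitive_0: "primitive f 0 = 0"
  by (simp add: primitive_eq_integral)

lemma primitive_has_real_derivative:
  assumes "0 < s"
  shows "(primitive f has_real_derivative f s) (at s)"
proof -
  have "((\<lambda>x. integral {0..x} f) has_real_derivative f s) (at s within {0..s + 1})"
    using assms by (intro integral_has_real_derivative continuous_on_f) auto
  then have "((\<lambda>x. integral {0..x} f) has_real_derivative f s) (at s)"
    using assms by (simp add: at_within_Icc_at)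
  then show ?thesis
    by (rule has_field_derivative_transform_within[where d=s])
      (use assms in \<open>auto simp: dist_real_def primitive_eq_integral\<close>)
qed

lemma continuous_on_primitive:
  assumes "0 \<le> a"
  shows "continuous_on {a..b} (primitive f)"
proof -
  have "continuous_on {0..b} (\<lambda>x. integral {0..x} f)"
    by (intro indefinite_integral_continuous_1 integrable_continuous_real continuous_on_f) auto
  then have "continuous_on {a..b} (\<lambda>x. integral {0..x} f)"
    by (rule continuous_on_subset) (use assms in auto)
  then show ?thesis
    by (rule continuous_on_eq) (use assms in \<open>auto simp: primitive_eq_integral\<close>)
qed

lemma f_neg:
  assumes "0 < s" "s < alpha f"
  shows "f s < 0"
proof (rule ccontr)
  assume "\<not> f s < 0"
  then have "alpha f \<le> s"
    unfolding alpha_def using assms by (intro cInf_lower) (auto intro: bdd_belowI[of _ 0])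
  with assms show False by simp
qed

lemma primitive_neg_below_alpha:
  assumes "0 < s" "s \<le> alpha f"
  shows "primitive f s < 0"
proof -
  have "primitive f s < primitive f 0"
  proof (rule DERIV_neg_imp_decreasing_open[OF \<open>0 < s\<close>])
    fix x assume "0 < x" "x < s"
    then show "\<exists>y. (primitive f has_real_derivative y) (at x) \<and> y < 0"
      using primitive_has_real_derivative[of x] f_neg[of x] assms by (intro exI[of _ "f x"]) auto
  qed (rule continuous_on_primitive, simp)
  then show ?thesis by (simp add: primitive_0)
qed

lemma xi0_lower: "0 < s \<Longrightarrow> 0 < primitive f s \<Longrightarrow> xi0 f \<le> s"
  unfolding xi0_def by (intro cInf_lower) (auto intro: bdd_belowI[of _ 0])

text \<open>
  The primitive decreases from \<open>0\<close> on \<open>[0, \<alpha>]\<close>, so it becomes positive only beyond \<open>\<alpha>\<close>; continuity makes it vanish at the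
  infimum of the points where it is positive.
\<close>

lemma alpha_less_xi0: "alpha f < xi0 f" and primitive_xi0: "primitive f (xi0 f) = 0"
proof -
  let ?S = "{\<xi>. \<xi> > 0 \<and> primitive f \<xi> > 0}"
  obtain \<gamma> where \<gamma>: "\<gamma> > 0" "primitive f \<gamma> > 0" using primitive_pos by blast
  have ge: "alpha f \<le> s" if "s \<in> ?S" for s
    using primitive_neg_below_alpha[of s] that by force
  have le: "alpha f \<le> xi0 f"
    unfolding xi0_def by (rule cInf_greatest[OF _ ge]) (use \<gamma> in auto)
  have nonneg: "0 \<le> primitive f (xi0 f)"
  proof (rule ccontr)
    assume *: "\<not> 0 \<le> primitive f (xi0 f)"
    have "xi0 f \<noteq> \<gamma>" using * \<gamma> by auto
    then have "xi0 f < \<gamma>" using xi0_lower[OF \<gamma>] by simp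
    obtain t where t: "xi0 f < t" "\<And>s. xi0 f \<le> s \<Longrightarrow> s < t \<Longrightarrow> primitive f s < 0"
      by (rule first_crossing[of "xi0 f" \<gamma> "primitive f" 0])
        (use * \<gamma> \<open>xi0 f < \<gamma>\<close> le alpha_pos in \<open>auto intro!: continuous_on_primitive\<close>)
    have "t \<le> xi0 f"
      unfolding xi0_def
    proof (rule cInf_greatest)
      fix s assume "s \<in> ?S"
      then show "t \<le> s" using t(2)[of s] xi0_lower[of s] by force
    qed (use \<gamma> in auto)
    with t show False by simp
  qed
  then show less: "alpha f < xi0 f"
    using le primitive_neg_below_alpha[of "alpha f"] alpha_pos by (cases "alpha f = xi0 f") auto
  show "primitive f (xi0 f) = 0"
  proof (rule ccontr)
    assume "primitive f (xi0 f) \<noteq> 0"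
    then have pos: "0 < primitive f (xi0 f)" using nonneg by simp
    then obtain t where t: "alpha f \<le> t" "t \<le> xi0 f" "primitive f t = primitive f (xi0 f) / 2"
      using IVT'[of "primitive f" "alpha f" "primitive f (xi0 f) / 2" "xi0 f"]
        primitive_neg_below_alpha[of "alpha f"] alpha_pos less continuous_on_primitive[of "alpha f"]
      by auto
    then have "xi0 f \<le> t" using xi0_lower[of t] pos alpha_pos by simp
    with t pos show False by simp
  qed
qed

lemma xi0_pos: "0 < xi0 f"
  using alpha_less_xi0 alpha_pos by simp

lemma primitive_neg:
  assumes "0 < s" "s < xi0 f"
  shows "primitive f s < 0"
proof (cases "s \<le> alpha f")
  case False
  have "primitive f s < primitive f (xi0 f)"
  proof (rule DERIV_pos_imp_increasing_open[OF \<open>s < xi0 f\<close>])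
    fix x assume x: "s < x" "x < xi0 f"
    show "\<exists>y. (primitive f has_real_derivative y) (at x) \<and> 0 < y"
      using primitive_has_real_derivative[of x] f_pos[of x] x assms False
      by (intro exI[of _ "f x"]) auto
  qed (use assms in \<open>auto intro: continuous_on_primitive\<close>)
  then show ?thesis by (simp add: primitive_xi0)
qed (use assms primitive_neg_below_alpha in auto)

text \<open>
  Constant continuation outside \<open>[0, M]\<close>; since \<open>f 0 = 0\<close>, it is zero on the negative half line.
\<close>

definition cutoff :: "real \<Rightarrow> real \<Rightarrow> real"
  where "cutoff M s = f (max 0 (min s M))"

lemma cutoff_eq: "0 \<le> s \<Longrightarrow> s \<le> M \<Longrightarrow> cutoff M s = f s"
  by (simp add: cutoff_def)

lemma cutoff_shooting:
  assumes M: "xi0 f < M" and pos: "\<And>s. xi0 f \<le> s \<Longrightarrow> s < M \<Longrightarrow> 0 < f s" and "m \<ge> 1"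
  obtains L B G where "ground_state_shooting (cutoff M) L B m G (xi0 f) M"
    "\<And>s. 0 \<le> s \<Longrightarrow> s \<le> M \<Longrightarrow> G s = primitive f s"
proof -
  have "M > 0" using M xi0_pos by simp
  obtain L where L: "L-lipschitz_on {0..M} f" by (rule lipschitz_on_Icc)
  have lip: "\<bar>cutoff M x - cutoff M y\<bar> \<le> max 1 L * \<bar>x - y\<bar>" for x y
  proof -
    have "\<bar>cutoff M x - cutoff M y\<bar> \<le> L * \<bar>max 0 (min x M) - max 0 (min y M)\<bar>"
      using lipschitz_onD[OF L, of "max 0 (min x M)" "max 0 (min y M)"] \<open>M > 0\<close>
      by (simp add: cutoff_def dist_real_def)
    also have "\<dots> \<le> max 1 L * \<bar>x - y\<bar>" by (intro mult_mono) auto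
    finally show ?thesis .
  qed
  have "compact (f ` {0..M})"
    by (intro compact_continuous_image continuous_on_f) auto
  then obtain B where B: "\<And>y. y \<in> f ` {0..M} \<Longrightarrow> \<bar>y\<bar> \<le> B"
    using compact_imp_bounded bounded_iff[of "f ` {0..M}"] by auto
  have bounded: "\<bar>cutoff M x\<bar> \<le> B" for x
    unfolding cutoff_def using \<open>M > 0\<close> by (intro B) auto
  interpret radial_ivp "cutoff M" "max 1 L" B m
    by unfold_locales (use lip bounded in auto)
  \<comment> \<open>Integrating from \<open>-1\<close>, inside the region where the cutoff vanishes, gives differentiability at \<open>0\<close> from both sides.\<close>
  define G where "G = (\<lambda>s. integral {-1..s} (cutoff M))"
  have cont: "continuous_on S (cutoff M)" for S
    using continuous_on_g[OF continuous_on_id] .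
  have zero: "cutoff M s = 0" if "s \<le> 0" for s
    using that \<open>M > 0\<close> by (simp add: cutoff_def f_0)
  have G_nonpos: "G s = 0" if "s \<le> 0" for s
  proof -
    have "G s = integral {-1..s} (\<lambda>_. 0)"
      unfolding G_def by (rule integral_cong) (use that zero in auto)
    then show ?thesis by simp
  qed
  have G_eq: "G s = primitive f s" if "0 \<le> s" "s \<le> M" for s
  proof -
    have "G s = integral {-1..0} (cutoff M) + integral {0..s} (cutoff M)"
      unfolding G_def
      by (rule Henstock_Kurzweil_Integration.integral_combine[symmetric])
        (use that in \<open>auto intro: integrable_continuous_real cont\<close>)
    also have "integral {-1..0} (cutoff M) = 0" using G_nonpos[of 0] by (simp add: G_def)
    also have "integral {0..s} (cutoff M) = integral {0..s} f"
      by (rule integral_cong) (use that in \<open>auto simp: cutoff_eq\<close>)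
    finally show ?thesis using that by (simp add: primitive_eq_integral)
  qed
  have G_deriv: "(G has_real_derivative cutoff M s) (at s)" for s
  proof (cases "s > -1")
    case True
    have "(G has_real_derivative cutoff M s) (at s within {-1..s + 1})"
      unfolding G_def using True by (intro integral_has_real_derivative cont) auto
    then show ?thesis using True by (simp add: at_within_Icc_at)
  next
    case False
    have "((\<lambda>_. 0) has_real_derivative cutoff M s) (at s)"
      using False by (simp add: zero)
    then show ?thesis
      by (rule has_field_derivative_transform_within[where d=1])
        (use False G_nonpos in \<open>auto simp: dist_real_def\<close>)
  qed
  have "ground_state_shooting (cutoff M) (max 1 L) B m G (xi0 f) M"
  proof unfold_locales
    fix s assume s: "xi0 f \<le> s" "s < M"
    then show "0 < cutoff M s" using pos[of s] xi0_pos by (simp add: cutoff_eq)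
  qed (use assms zero G_nonpos G_deriv xi0_pos primitive_neg primitive_xi0 G_eq in auto)
  then show thesis using G_eq by (rule that)
qed

text \<open>
  By \<open>exp (- x) \<ge> 1 - x\<close> it is enough that \<open>(p + c) * (k / R) < p\<close>; the choice of \<open>R\<close> makes the left side \<open>p / 2\<close>.
\<close>

lemma friction_radius:
  assumes "0 < p" "0 < c" "0 < k"
  obtains R :: real where "R > 0" "c < (p + c) * exp (- (k / R))"
proof
  define R where "R = 2 * k * (p + c) / p"
  show "R > 0" using assms by (simp add: R_def)
  have "c < (p + c) * (1 - k / R)"
  proof -
    have "k / R = p / (2 * (p + c))" using assms by (simp add: R_def)
    then have "(p + c) * (1 - k / R) = p / 2 + c"
      using assms by (simp add: field_simps)
    then show ?thesis using assms by simp
  qed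
  also have "\<dots> \<le> (p + c) * exp (- (k / R))"
    using assms exp_ge_add_one_self[of "- (k / R)"] by (intro mult_left_mono) auto
  finally show "c < (p + c) * exp (- (k / R))" .
qed

text \<open>
  The constants \<open>C\<close> and \<open>R\<close> depend only on \<open>f\<close> below the level \<open>\<xi>\<^sub>1\<close>, so the cutoff point \<open>M\<close> and the
  initial value \<open>\<xi>\<^sub>2\<close> may be chosen after them.
\<close>

lemma reaching_amplitude:
  assumes "m \<ge> 1"
  obtains M L B G \<xi>\<^sub>2 where "ground_state_shooting (cutoff M) L B m G (xi0 f) M"
    "xi0 f \<le> \<xi>\<^sub>2" "\<xi>\<^sub>2 < M" "\<exists>r\<ge>0. radial_ivp.profile (cutoff M) L m \<xi>\<^sub>2 r < 0"
proof -
  have radius: "\<exists>C R. R > 0 \<and> (\<forall>s\<in>{0..\<xi>\<^sub>1}. 1 - primitive f s \<le> C) \<and>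
      C < (primitive f \<xi>\<^sub>1 + C) * exp (- (real m * \<xi>\<^sub>1 / R))"
    if "xi0 f < \<xi>\<^sub>1" and pos: "\<forall>s\<in>{xi0 f..\<xi>\<^sub>1}. 0 < f s" for \<xi>\<^sub>1
  proof -
    have "compact (primitive f ` {0..\<xi>\<^sub>1})"
      by (intro compact_continuous_image continuous_on_primitive) auto
    then obtain b where b: "\<And>y. y \<in> primitive f ` {0..\<xi>\<^sub>1} \<Longrightarrow> \<bar>y\<bar> \<le> b"
      using compact_imp_bounded bounded_iff[of "primitive f ` {0..\<xi>\<^sub>1}"] by auto
    have C: "1 - primitive f s \<le> 1 + b" if "s \<in> {0..\<xi>\<^sub>1}" for s
      using b[of "primitive f s"] that by (auto simp: abs_le_iff)
    have "primitive f (xi0 f) < primitive f \<xi>\<^sub>1"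
    proof (rule DERIV_pos_imp_increasing[OF \<open>xi0 f < \<xi>\<^sub>1\<close>])
      fix x assume x: "xi0 f \<le> x" "x \<le> \<xi>\<^sub>1"
      then show "\<exists>y. (primitive f has_real_derivative y) (at x) \<and> 0 < y"
        using primitive_has_real_derivative[of x] pos x xi0_pos by auto
    qed
    moreover have "1 \<le> 1 + b" using C[of 0] xi0_pos \<open>xi0 f < \<xi>\<^sub>1\<close> by (simp add: primitive_0)
    ultimately obtain R where "R > 0" "1 + b < (primitive f \<xi>\<^sub>1 + (1 + b)) * exp (- (real m * \<xi>\<^sub>1 / R))"
      using friction_radius[of "primitive f \<xi>\<^sub>1" "1 + b" "real m * \<xi>\<^sub>1"] assms xi0_pos
        \<open>xi0 f < \<xi>\<^sub>1\<close> primitive_xi0 by auto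
    then show ?thesis using C by blast
  qed
  show thesis
  proof (cases "\<exists>s>xi0 f. f s \<le> 0")
    case False
    then have pos: "0 < f s" if "xi0 f \<le> s" for s
      using that f_pos[of "xi0 f"] alpha_less_xi0
      by (cases "s = xi0 f") (auto simp: not_le order_le_less)
    define \<xi>\<^sub>1 where "\<xi>\<^sub>1 = xi0 f + 1"
    have "xi0 f < \<xi>\<^sub>1" "\<forall>s\<in>{xi0 f..\<xi>\<^sub>1}. 0 < f s" using pos by (auto simp: \<xi>\<^sub>1_def)
    from radius[OF this] obtain C R where CR: "R > 0" "\<forall>s\<in>{0..\<xi>\<^sub>1}. 1 - primitive f s \<le> C"
        "C < (primitive f \<xi>\<^sub>1 + C) * exp (- (real m * \<xi>\<^sub>1 / R))"
      by blast
    \<comment> \<open>With velocity less than \<open>1\<close>, the profile stays above \<open>\<xi>\<^sub>1 + 1\<close> up to radius \<open>R\<close>.\<close>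
    define \<xi>\<^sub>2 where "\<xi>\<^sub>2 = \<xi>\<^sub>1 + R + 1"
    define M where "M = \<xi>\<^sub>2 + 1"
    have order: "xi0 f < \<xi>\<^sub>1" "\<xi>\<^sub>1 < \<xi>\<^sub>2" "\<xi>\<^sub>2 < M"
      using CR(1) by (auto simp: \<xi>\<^sub>1_def \<xi>\<^sub>2_def M_def)
    obtain L B G where S: "ground_state_shooting (cutoff M) L B m G (xi0 f) M"
        and G: "\<And>s. 0 \<le> s \<Longrightarrow> s \<le> M \<Longrightarrow> G s = primitive f s"
      using cutoff_shooting[of M m] order pos assms by (metis order_less_trans)
    interpret ground_state_shooting "cutoff M" L B m G "xi0 f" M by (rule S)
    have "\<exists>r\<ge>0. profile \<xi>\<^sub>2 r < 0"
    proof (rule profile_reaches_zero[OF order CR(1)])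
      fix r assume "0 \<le> r" "r \<le> R"
      then show "\<xi>\<^sub>1 < profile \<xi>\<^sub>2 r"
        using abs_profile_diff_initial_le[of r \<xi>\<^sub>2] by (simp add: \<xi>\<^sub>2_def)
    qed (use CR G order \<xi>\<^sub>0_pos in auto)
    from that[OF S _ order(3) this] order show thesis by simp
  next
    case True
    then obtain b where b: "xi0 f < b" "f b \<le> 0" by blast
    have "continuous_on {xi0 f..b} (\<lambda>s. - f s)"
      using xi0_pos by (intro continuous_on_minus continuous_on_f) auto
    then obtain M where M: "xi0 f < M" "f M = 0" and "\<And>s. xi0 f \<le> s \<Longrightarrow> s < M \<Longrightarrow> - f s < 0"
      by (rule first_crossing[of "xi0 f" b "\<lambda>s. - f s" 0])
        (use b f_pos[of "xi0 f"] alpha_less_xi0 in auto)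
    then have pos: "0 < f s" if "xi0 f \<le> s" "s < M" for s using that by force
    define \<xi>\<^sub>1 where "\<xi>\<^sub>1 = (xi0 f + M) / 2"
    have \<xi>\<^sub>1: "xi0 f < \<xi>\<^sub>1" "\<xi>\<^sub>1 < M" using M by (auto simp: \<xi>\<^sub>1_def)
    have "\<forall>s\<in>{xi0 f..\<xi>\<^sub>1}. 0 < f s" using pos \<xi>\<^sub>1 by auto
    from radius[OF \<xi>\<^sub>1(1) this] obtain C R where CR: "R > 0" "\<forall>s\<in>{0..\<xi>\<^sub>1}. 1 - primitive f s \<le> C"
        "C < (primitive f \<xi>\<^sub>1 + C) * exp (- (real m * \<xi>\<^sub>1 / R))"
      by blast
    obtain L B G where S: "ground_state_shooting (cutoff M) L B m G (xi0 f) M"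
        and G: "\<And>s. 0 \<le> s \<Longrightarrow> s \<le> M \<Longrightarrow> G s = primitive f s"
      using cutoff_shooting[of M m] M pos assms by metis
    interpret ground_state_shooting "cutoff M" L B m G "xi0 f" M by (rule S)
    define e where "e = exp (L * R\<^sup>2)"
    have "e \<ge> 1" using L_ge_1 by (simp add: e_def)
    \<comment> \<open>The profile starting at \<open>M - \<eta>\<close> departs from \<open>M\<close> by at most \<open>2 * e * \<eta>\<close> on \<open>[0, R]\<close>, half the distance to \<open>\<xi>\<^sub>1\<close>.\<close>
    define \<eta> where "\<eta> = (M - \<xi>\<^sub>1) / (4 * e)"
    have "\<eta> \<le> (M - \<xi>\<^sub>1) / 4"
      unfolding \<eta>_def using \<open>e \<ge> 1\<close> \<xi>\<^sub>1 by (intro divide_left_mono) auto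
    moreover have "0 < \<eta>" using \<open>e \<ge> 1\<close> \<xi>\<^sub>1 by (simp add: \<eta>_def)
    moreover define \<xi>\<^sub>2 where "\<xi>\<^sub>2 = M - \<eta>"
    ultimately have order: "\<xi>\<^sub>1 < \<xi>\<^sub>2" "\<xi>\<^sub>2 < M" using \<xi>\<^sub>1 by auto
    have equilibrium: "profile M r = M" for r
      using M xi0_pos by (intro profile_equilibrium) (simp add: cutoff_eq)
    have "\<exists>r\<ge>0. profile \<xi>\<^sub>2 r < 0"
    proof (rule profile_reaches_zero[OF \<xi>\<^sub>1(1) order CR(1)])
      fix r assume r: "0 \<le> r" "r \<le> R"
      have "\<bar>profile M r - profile \<xi>\<^sub>2 r\<bar> \<le> 2 * exp (L * r\<^sup>2) * \<bar>M - \<xi>\<^sub>2\<bar>"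
        by (rule abs_profile_diff_le)
      also have "\<dots> \<le> 2 * e * \<bar>M - \<xi>\<^sub>2\<bar>"
        unfolding e_def using r L_ge_1 by (intro mult_right_mono) (auto intro!: power_mono)
      also have "\<dots> = (M - \<xi>\<^sub>1) / 2"
        using \<open>e \<ge> 1\<close> \<xi>\<^sub>1 by (simp add: \<xi>\<^sub>2_def \<eta>_def)
      finally have "M - profile \<xi>\<^sub>2 r \<le> (M - \<xi>\<^sub>1) / 2"
        unfolding equilibrium by (rule abs_le_D1)
      also have "\<dots> < M - \<xi>\<^sub>1" using \<xi>\<^sub>1 by simp
      finally show "\<xi>\<^sub>1 < profile \<xi>\<^sub>2 r" by simp
    qed (use CR G \<xi>\<^sub>1 \<xi>\<^sub>0_pos in auto)
    from that[OF S _ order(2) this] order \<xi>\<^sub>1 show thesis by simp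
  qed
qed

lemma ground_state_exists:
  assumes "CARD('n::finite) \<ge> 2"
  shows "\<exists>u :: real ^ 'n \<Rightarrow> real. classical_solution f u \<and> radially_decreasing u"
proof -
  define m where "m = CARD('n) - 1"
  have m: "m \<ge> 1" "CARD('n) = Suc m" using assms by (auto simp: m_def)
  obtain M L B G \<xi>\<^sub>2 where S: "ground_state_shooting (cutoff M) L B m G (xi0 f) M"
      and \<xi>\<^sub>2: "xi0 f \<le> \<xi>\<^sub>2" "\<xi>\<^sub>2 < M" "\<exists>r\<ge>0. radial_ivp.profile (cutoff M) L m \<xi>\<^sub>2 r < 0"
    using reaching_amplitude[OF m(1)] .
  interpret ground_state_shooting "cutoff M" L B m G "xi0 f" M by (rule S)
  show ?thesis
  proof (rule shooting[OF \<xi>\<^sub>2])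
    fix \<xi>
    assume \<xi>: "xi0 f \<le> \<xi>" "\<xi> < M" and pos: "\<And>r. 0 \<le> r \<Longrightarrow> 0 < profile \<xi> r"
      and neg: "\<And>r. 0 < r \<Longrightarrow> momentum \<xi> r < 0" and lim: "(profile \<xi> \<longlongrightarrow> 0) at_top"
    have f_eq: "f (profile \<xi> r) = cutoff M (profile \<xi> r)" if "0 \<le> r" for r
    proof -
      have "profile \<xi> r \<le> \<xi>"
        using profile_strict_decreasing[of 0 r \<xi>] neg that by (cases "r = 0") auto
      then show ?thesis using pos[OF that] \<xi> by (simp add: cutoff_eq)
    qed
    have "classical_solution f (\<lambda>x :: real ^ 'n. profile \<xi> (norm x))"
      using m(2) pos lim f_eq by (rule classical_solution_radial_profile)
    moreover have "radially_decreasing (\<lambda>x :: real ^ 'n. profile \<xi> (norm x))"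
      using neg by (rule radially_decreasing_radial_profile)
    ultimately show ?thesis by blast
  qed
qed

end

theorem theorem0p1:
  fixes f :: "real \<Rightarrow> real"
  assumes N: "CARD('n::finite) \<ge> 2"
    and f1: "f 0 = 0"
    and f2: "locally_lipschitz_on {0..} f"
    and f3: "{\<xi>. \<xi> > 0 \<and> f \<xi> \<ge> 0} \<noteq> {}" "alpha f > 0"
    and f4: "CARD('n) \<ge> 3 \<Longrightarrow>
      \<exists>l>0. ((\<lambda>s. f s / (s - alpha f)) \<longlongrightarrow> l) (at_right (alpha f))"
    and f5: "\<exists>\<gamma>>0. primitive f \<gamma> > 0"
    and f6: "\<forall>\<xi>\<in>{alpha f<..xi0 f}. f \<xi> > 0"
  shows "\<exists>u :: real ^ 'n \<Rightarrow> real. classical_solution f u \<and> radially_decreasing u"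
proof -
  interpret ground_state_nonlinearity f
    by unfold_locales (use f1 f2 f3 f5 f6 in auto)
  show ?thesis by (rule ground_state_exists[OF N])
qed

end
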